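(* The pure flat braid group $\mathrm{PFB}_7$ is not virtually a right-angled Artin group, i.e.\ it contains no finite-index subgroup isomorphic to a right-angled Artin group.
   Context: $\mathrm{FB}_7=\langle \sigma_1,\ldots,\sigma_6\mid \sigma_i^2=1,\ [\sigma_i,\sigma_j]=1 \text{ whenever } |i-j|\ge 2\rangle$, and $\mathrm{PFB}_7$ is the kernel of the homomorphism $\mathrm{FB}_7\to \mathrm{Sym}(7)$ sending $\sigma_i$ to the transposition $(i,i+1)$. For a graph $\Gamma$, $A(\Gamma)=\langle u\in V(\Gamma)\mid [u,v]=1 \text{ for adjacent } u,v\rangle$. *)

theory Defs
  imports "HOL-Algebra.Algebra" "HOL-Combinatorics.Transposition"
begin

text \<open>A letter is a generator together with a sign (True = positive, False = inverse).
  Elements of the free group on S are freely reduced words over S.\<close>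

type_synonym 'a word = "('a \<times> bool) list"

fun cancel_cons :: "'a \<times> bool \<Rightarrow> 'a word \<Rightarrow> 'a word" where
  "cancel_cons a [] = [a]"
| "cancel_cons a (b # ws) =
     (if fst a = fst b \<and> snd a \<noteq> snd b then ws else a # b # ws)"

definition reduce :: "'a word \<Rightarrow> 'a word" where
  "reduce w = foldr cancel_cons w []"

fun reduced :: "'a word \<Rightarrow> bool" where
  "reduced [] = True"
| "reduced [a] = True"
| "reduced (a # b # ws) =
     (\<not> (fst a = fst b \<and> snd a \<noteq> snd b) \<and> reduced (b # ws))"

definition word_inv :: "'a word \<Rightarrow> 'a word" where
  "word_inv w = rev (map (\<lambda>(x, b). (x, \<not> b)) w)"

definition free_group :: "'a set \<Rightarrow> 'a word monoid" where
  "free_group S = \<lparr> carrier = {w. reduced w \<and> fst ` set w \<subseteq> S},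
                    monoid.mult = (\<lambda>u v. reduce (u @ v)), one = [] \<rparr>"

definition normal_closure :: "'a set \<Rightarrow> 'a word set \<Rightarrow> 'a word set" where
  "normal_closure S R =
     generate (free_group S)
       {reduce (g @ r @ word_inv g) | g r. g \<in> carrier (free_group S) \<and> r \<in> R}"

definition presentation :: "'a set \<Rightarrow> 'a word set \<Rightarrow> 'a word set monoid" where
  "presentation S R = free_group S Mod normal_closure S R"

definition FB7_relators :: "nat word set" where
  "FB7_relators =
     {[(i, True), (i, True)] | i. i \<in> {1..6}}
   \<union> {[(i, True), (j, True), (i, False), (j, False)] | i j.
        i \<in> {1..6} \<and> j \<in> {1..6} \<and> (i \<ge> j + 2 \<or> j \<ge> i + 2)}"

definition FB7 :: "nat word set monoid" where
  "FB7 = presentation {1..6} FB7_relators"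

definition word_perm :: "nat word \<Rightarrow> nat \<Rightarrow> nat" where
  "word_perm w = foldr (\<lambda>(i, b) p. transpose i (i + 1) \<circ> p) w id"

text \<open>The induced homomorphism FB_7 to Sym(7) (sym_group 7 acts on {1..7}),
  evaluated on a representative of the coset.\<close>
definition FB7_to_Sym7 :: "nat word set \<Rightarrow> nat \<Rightarrow> nat" where
  "FB7_to_Sym7 c = word_perm (SOME w. w \<in> c)"

definition PFB7 :: "nat word set monoid" where
  "PFB7 = FB7 \<lparr> carrier := kernel FB7 (sym_group 7) FB7_to_Sym7 \<rparr>"

definition raag_relators :: "'v set \<Rightarrow> ('v \<Rightarrow> 'v \<Rightarrow> bool) \<Rightarrow> 'v word set" where
  "raag_relators V E =
     {[(u, True), (v, True), (u, False), (v, False)] | u v. u \<in> V \<and> v \<in> V \<and> E u v}"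

definition raag :: "'v set \<Rightarrow> ('v \<Rightarrow> 'v \<Rightarrow> bool) \<Rightarrow> 'v word set monoid" where
  "raag V E = presentation V (raag_relators V E)"

end

theory Submission
  imports Defs
begin

text \<open>
  \<open>FB7\<close> is the right-angled Coxeter group on \<open>\<sigma>\<^sub>1, \<dots>, \<sigma>\<^sub>6\<close>. For \<open>t = 3, 4\<close> it acts on the Bass--Serre
  tree of its splitting over \<open>K\<^sub>t = \<langle>\<sigma>\<^sub>i | i \<in> link t\<rangle>\<close>; the signed geodesic from the base edge to its
  translate by \<open>g\<close> is a derivation \<open>edge_path t\<close> from \<open>FB7\<close> to \<open>\<int>[FB7 / K\<^sub>t]\<close>, which the presentation
  allows one to write down without constructing the tree. Suppose that a finite-index subgroup \<open>H\<close>
  of \<open>PFB7\<close> is isomorphic to \<open>A(\<Gamma>)\<close>.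

  If every vertex of \<open>\<Gamma>\<close> has a neighbour, each generator \<open>u\<close> belongs to a commuting independent pair.
  Counting with sign the crossings of a suitable \<open>PFB7\<close>-invariant set of edges for \<open>t = 3\<close> gives a
  homomorphism from \<open>PFB7\<close> to \<open>\<int>\<close>, which takes the value \<open>-1\<close> at \<open>(\<sigma>\<^sub>3 \<sigma>\<^sub>4)\<^sup>3\<close>, a cycle in the quotient
  graph. It vanishes at \<open>u\<close>: either the pair acts freely on the edges and the derivation is inner on
  it, or \<open>u\<close> lies in a vertex stabiliser, on which the count telescopes to \<open>0\<close>. So it vanishes on \<open>H\<close>,
  a contradiction.

  If \<open>s\<close> is an isolated vertex of \<open>\<Gamma>\<close>, the Fox derivative with respect to \<open>s\<close> is inner on every
  free abelian group generated by a commuting independent pair. The conjugates of suitable powers of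
  \<open>\<sigma>\<^sub>1 \<sigma>\<^sub>2\<close> and \<open>\<sigma>\<^sub>5 \<sigma>\<^sub>6\<close> form a connected network of such pairs, because each generator of \<open>FB7\<close>
  commutes with one of the two powers. So one chain works for all of them, the derivative is inner
  on \<open>H\<close>, and augmentation gives \<open>1 = 0\<close> at \<open>s\<close>.
\<close>

subsection \<open>Free groups and presentations\<close>

lemma reduced_Cons_tl: "reduced (a # w) \<Longrightarrow> reduced w"
  by (cases w) auto

lemma reduced_cancel_cons: "reduced w \<Longrightarrow> reduced (cancel_cons a w)"
  by (cases w) (auto dest: reduced_Cons_tl)

lemma cancel_cons_reduced: "reduced (a # w) \<Longrightarrow> cancel_cons a w = a # w"
  by (cases w) auto

text \<open>Opposite letters act on reduced words as mutually inverse maps. Reducedness of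
  \<open>w\<close> enters when \<open>b\<close> cancels its head \<open>c\<close>: then
  \<open>c = a\<close>, and putting \<open>a\<close> back must not trigger a second
  cancellation.\<close>

lemma cancel_cons_cancel:
  assumes "reduced w" "fst a = fst b" "snd a \<noteq> snd b"
  shows "cancel_cons a (cancel_cons b w) = w"
proof (cases w)
  case (Cons c v)
  show ?thesis
  proof (cases "fst b = fst c \<and> snd b \<noteq> snd c")
    case True
    then have "a = c" using assms(2,3) by (auto simp: prod_eq_iff)
    with True Cons assms(1) show ?thesis by (simp add: cancel_cons_reduced)
  qed (use Cons assms in auto)
qed (use assms in auto)

lemma reduced_foldr_cancel_cons: "reduced v \<Longrightarrow> reduced (foldr cancel_cons u v)"
  by (induction u) (auto intro: reduced_cancel_cons)

lemma reduced_reduce: "reduced (reduce w)"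
  unfolding reduce_def by (rule reduced_foldr_cancel_cons) simp

lemma reduce_reduced: "reduced w \<Longrightarrow> reduce w = w"
  unfolding reduce_def
  by (induction w) (use cancel_cons_reduced reduced_Cons_tl in fastforce)+

lemma reduce_append: "reduce (u @ v) = foldr cancel_cons u (reduce v)"
  by (simp add: reduce_def)

text \<open>Van der Waerden's trick: letters act on reduced words through
  \<open>cancel_cons\<close>, and a word and its reduction act alike. Associativity in the free
  group follows from this without a confluence argument.\<close>

lemma foldr_cancel_cons:
  assumes "reduced v"
  shows "foldr cancel_cons (cancel_cons a u) v = cancel_cons a (foldr cancel_cons u v)"
proof (cases u)
  case (Cons b w)
  then show ?thesis
    using cancel_cons_cancel[OF reduced_foldr_cancel_cons[OF assms, of w], of a b] by simp
qed simp

lemma foldr_reduce: "reduced v \<Longrightarrow> foldr cancel_cons (reduce u) v = foldr cancel_cons u v"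
  by (induction u) (simp_all add: reduce_def foldr_cancel_cons)

lemma reduce_append_reduce [simp]: "reduce (u @ reduce v) = reduce (u @ v)"
  by (simp add: reduce_append reduce_reduced reduced_reduce)

lemma reduce_reduce_append [simp]: "reduce (reduce u @ v) = reduce (u @ v)"
  by (simp add: reduce_append foldr_reduce reduced_reduce)

lemma set_cancel_cons: "set (cancel_cons a w) \<subseteq> insert a (set w)"
  by (cases w) auto

lemma set_reduce: "set (reduce w) \<subseteq> set w"
  unfolding reduce_def using set_cancel_cons by (induction w) fastforce+

lemma word_inv_Cons: "word_inv (a # w) = word_inv w @ [(fst a, \<not> snd a)]"
  by (auto simp: word_inv_def split: prod.splits)

lemma fst_set_word_inv: "fst ` set (word_inv w) = fst ` set w"
  by (force simp: word_inv_def image_iff)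

lemma reduce_word_inv_append: "reduce (word_inv w @ w) = []"
proof -
  have "foldr cancel_cons (word_inv w) (foldr cancel_cons w v) = v" if "reduced v" for v
  proof (induction w)
    case (Cons a w)
    then show ?case
      using cancel_cons_cancel[OF reduced_foldr_cancel_cons[OF that, of w], of "(fst a, \<not> snd a)" a]
      by (simp add: word_inv_Cons)
  qed (simp add: word_inv_def)
  from this[of "[]"] show ?thesis by (simp add: reduce_def)
qed

lemma free_group_simps [simp]:
  "monoid.mult (free_group S) u v = reduce (u @ v)" "one (free_group S) = []"
  "w \<in> carrier (free_group S) \<longleftrightarrow> reduced w \<and> fst ` set w \<subseteq> S"
  by (auto simp: free_group_def)

lemma reduce_in_free_group: "fst ` set w \<subseteq> S \<Longrightarrow> reduce w \<in> carrier (free_group S)"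
  using set_reduce[of w] by (auto simp: reduced_reduce)

lemma group_free_group: "group (free_group S)"
proof (rule groupI)
  fix u v assume "u \<in> carrier (free_group S)" "v \<in> carrier (free_group S)"
  then show "u \<otimes>\<^bsub>free_group S\<^esub> v \<in> carrier (free_group S)"
    using reduce_in_free_group[of "u @ v" S] by auto
next
  fix w assume "w \<in> carrier (free_group S)"
  then show "\<exists>v\<in>carrier (free_group S). v \<otimes>\<^bsub>free_group S\<^esub> w = \<one>\<^bsub>free_group S\<^esub>"
    by (intro bexI[of _ "reduce (word_inv w)"] reduce_in_free_group)
       (auto simp: reduce_word_inv_append fst_set_word_inv)
qed (auto simp: reduce_reduced)

interpretation free: group "free_group S" for S
  by (rule group_free_group)

lemma inv_free_group:
  assumes "fst ` set w \<subseteq> S"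
  shows "inv\<^bsub>free_group S\<^esub> (reduce w) = reduce (word_inv w)"
  using assms
  by (intro free.inv_equality reduce_in_free_group)
     (auto simp: reduce_word_inv_append fst_set_word_inv)

text \<open>Conjugating a \<open>k\<close>-conjugate of a relator by \<open>g\<close> gives its
  conjugate by \<open>g k\<close>, so the generating set is itself closed under conjugation.\<close>

lemma normal_normal_closure:
  assumes R: "\<And>r. r \<in> R \<Longrightarrow> fst ` set r \<subseteq> S"
  shows "normal_closure S R \<lhd> free_group S"
  unfolding normal_closure_def
proof (rule free.normal_generateI)
  let ?F = "free_group S"
  let ?C = "{reduce (g @ r @ word_inv g) | g r. g \<in> carrier ?F \<and> r \<in> R}"
  have eq: "reduce (g @ r @ word_inv g) = g \<otimes>\<^bsub>?F\<^esub> reduce r \<otimes>\<^bsub>?F\<^esub> inv\<^bsub>?F\<^esub> g"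
    if "g \<in> carrier ?F" for g r
    using inv_free_group[of g S] that by (simp add: reduce_reduced)
  have rF: "reduce r \<in> carrier ?F" if "r \<in> R" for r
    using R that by (intro reduce_in_free_group) auto
  show "?C \<subseteq> carrier ?F"
  proof
    fix h assume "h \<in> ?C"
    then obtain g r where g: "g \<in> carrier ?F" "r \<in> R" "h = reduce (g @ r @ word_inv g)" by auto
    then show "h \<in> carrier ?F"
      unfolding g(3) eq[OF g(1)] by (intro free.m_closed free.inv_closed rF)
  qed
  fix h g assume "h \<in> ?C" and g: "g \<in> carrier ?F"
  then obtain k r where k: "k \<in> carrier ?F" "r \<in> R" "h = reduce (k @ r @ word_inv k)" by auto
  have "g \<otimes>\<^bsub>?F\<^esub> h \<otimes>\<^bsub>?F\<^esub> inv\<^bsub>?F\<^esub> g = (g \<otimes>\<^bsub>?F\<^esub> k) \<otimes>\<^bsub>?F\<^esub> reduce r \<otimes>\<^bsub>?F\<^esub> inv\<^bsub>?F\<^esub> (g \<otimes>\<^bsub>?F\<^esub> k)"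
    unfolding k(3) eq[OF k(1)] using g k(1) rF[OF k(2)]
    by (simp only: free.inv_mult_group free.m_assoc free.m_closed free.inv_closed)
  then show "g \<otimes>\<^bsub>?F\<^esub> h \<otimes>\<^bsub>?F\<^esub> inv\<^bsub>?F\<^esub> g \<in> ?C"
    using eq[of "g \<otimes>\<^bsub>?F\<^esub> k" r] free.m_closed[OF g k(1)] k(2) by force
qed

section \<open>Evaluation of words in a group\<close>

definition (in monoid) word_val :: "('s \<Rightarrow> 'a) \<Rightarrow> 's word \<Rightarrow> 'a" where
  "word_val \<phi> w = foldr (\<lambda>(x, b) a. (if b then \<phi> x else inv (\<phi> x)) \<otimes> a) w \<one>"

context group
begin

lemma word_val_simps [simp]:
  "word_val \<phi> [] = \<one>"
  "word_val \<phi> ((x, b) # w) = (if b then \<phi> x else inv (\<phi> x)) \<otimes> word_val \<phi> w"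
  by (simp_all add: word_val_def)

lemma word_val_closed:
  "fst ` set w \<subseteq> S \<Longrightarrow> \<phi> \<in> S \<rightarrow> carrier G \<Longrightarrow> word_val \<phi> w \<in> carrier G"
proof (induction w)
  case (Cons a w)
  then show ?case by (cases a) auto
qed simp

lemma word_val_append:
  assumes "fst ` set u \<subseteq> S" "fst ` set v \<subseteq> S" "\<phi> \<in> S \<rightarrow> carrier G"
  shows "word_val \<phi> (u @ v) = word_val \<phi> u \<otimes> word_val \<phi> v"
  using assms(1)
proof (induction u)
  case (Cons a u)
  have "word_val \<phi> u \<in> carrier G" "word_val \<phi> v \<in> carrier G" "\<phi> (fst a) \<in> carrier G"
    using Cons assms word_val_closed[OF _ assms(3)] by auto
  with Cons assms show ?case by (cases a) (auto simp: m_assoc)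
qed (use word_val_closed[OF assms(2,3)] in auto)

lemma word_val_cancel_cons:
  assumes "fst ` set w \<subseteq> S" "x \<in> S" "\<phi> \<in> S \<rightarrow> carrier G"
  shows "word_val \<phi> (cancel_cons (x, b) w) = word_val \<phi> ((x, b) # w)"
proof (cases w)
  case (Cons a v)
  have "word_val \<phi> v \<in> carrier G" "\<phi> x \<in> carrier G"
    using Cons assms word_val_closed[OF _ assms(3)] by auto
  then show ?thesis using Cons by (cases a) (auto simp: m_assoc[symmetric])
qed simp

text \<open>Evaluation is set up on all words because relators need not be reduced: a loop
  \<open>E u u\<close> yields the relator \<open>u u u^-1 u^-1\<close>. This lemma connects it with
  the free group.\<close>

lemma word_val_reduce:
  assumes "fst ` set w \<subseteq> S" "\<phi> \<in> S \<rightarrow> carrier G"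
  shows "word_val \<phi> (reduce w) = word_val \<phi> w"
  using assms(1)
proof (induction w)
  case (Cons a w)
  have "fst ` set (reduce w) \<subseteq> S" using set_reduce[of w] Cons.prems by auto
  then have "word_val \<phi> (cancel_cons a (reduce w)) = word_val \<phi> (a # reduce w)"
    using word_val_cancel_cons[of "reduce w" S "fst a" \<phi> "snd a"] Cons.prems assms(2) by simp
  moreover have "reduce (a # w) = cancel_cons a (reduce w)" by (simp add: reduce_def)
  ultimately show ?case using Cons by (cases a) auto
qed (simp add: reduce_def)

lemma word_val_hom:
  assumes "\<phi> \<in> S \<rightarrow> carrier G"
  shows "word_val \<phi> \<in> hom (free_group S) G"
proof (rule homI)
  fix u v assume uv: "u \<in> carrier (free_group S)" "v \<in> carrier (free_group S)"
  then show "word_val \<phi> (u \<otimes>\<^bsub>free_group S\<^esub> v) = word_val \<phi> u \<otimes> word_val \<phi> v"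
    using word_val_reduce[OF _ assms, of "u @ v"] word_val_append[OF _ _ assms, of u v] by auto
qed (use word_val_closed[OF _ assms] in auto)

lemma word_val_word_inv:
  assumes "fst ` set w \<subseteq> S" "\<phi> \<in> S \<rightarrow> carrier G"
  shows "word_val \<phi> (word_inv w) = inv (word_val \<phi> w)"
proof -
  have S: "fst ` set (word_inv w) \<subseteq> S" "fst ` set (word_inv w @ w) \<subseteq> S"
    using assms(1) by (simp_all add: fst_set_word_inv image_Un)
  have "word_val \<phi> (word_inv w @ w) = word_val \<phi> (reduce (word_inv w @ w))"
    by (rule word_val_reduce[OF S(2) assms(2), symmetric])
  then have "word_val \<phi> (word_inv w) \<otimes> word_val \<phi> w = \<one>"
    using assms word_val_append[of "word_inv w" S w \<phi>]
    by (simp add: reduce_word_inv_append fst_set_word_inv)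
  then show ?thesis
    by (intro inv_equality[symmetric] word_val_closed[OF S(1) assms(2)] word_val_closed[OF assms])
qed

end

section \<open>Presented groups and von Dyck's theorem\<close>

definition gen :: "'s set \<Rightarrow> 's word set \<Rightarrow> 's \<Rightarrow> 's word set" where
  "gen S R s = normal_closure S R #>\<^bsub>free_group S\<^esub> [(s, True)]"

locale presented =
  fixes S :: "'s set" and R :: "'s word set"
  assumes relators: "r \<in> R \<Longrightarrow> fst ` set r \<subseteq> S"
begin

sublocale normal "normal_closure S R" "free_group S"
  using normal_normal_closure relators by blast

sublocale P: group "presentation S R"
  unfolding presentation_def by (rule factorgroup_is_group)

abbreviation cls :: "'s word \<Rightarrow> 's word set" where
  "cls w \<equiv> normal_closure S R #>\<^bsub>free_group S\<^esub> w"

lemma presentation_cases: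
  assumes "c \<in> carrier (presentation S R)"
  obtains w where "w \<in> carrier (free_group S)" "c = cls w"
  using assms by (auto simp: presentation_def FactGroup_def RCOSETS_def)

lemma cls_hom: "cls \<in> hom (free_group S) (presentation S R)"
  unfolding presentation_def by (rule r_coset_hom_Mod)

lemma gen_closed: "s \<in> S \<Longrightarrow> gen S R s \<in> carrier (presentation S R)"
  unfolding gen_def by (rule hom_in_carrier[OF cls_hom]) simp

lemma gen_Pi: "gen S R \<in> S \<rightarrow> carrier (presentation S R)"
  using gen_closed by auto

lemma cls_eq_word_val:
  assumes "w \<in> carrier (free_group S)"
  shows "cls w = P.word_val (gen S R) w"
  using assms
proof (induction w)
  case Nil
  interpret group_hom "free_group S" "presentation S R" cls
    using cls_hom by (unfold_locales) auto
  show ?case using hom_one by simp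
next
  case (Cons a w)
  interpret group_hom "free_group S" "presentation S R" cls
    using cls_hom by (unfold_locales) auto
  obtain x b where a: "a = (x, b)" by force
  have w: "w \<in> carrier (free_group S)" and x: "x \<in> S"
    using Cons.prems a by (auto dest: reduced_Cons_tl)
  have "a # w = [a] \<otimes>\<^bsub>free_group S\<^esub> w"
    using Cons.prems by (simp add: reduce_reduced)
  then have "cls (a # w) = cls [a] \<otimes>\<^bsub>presentation S R\<^esub> cls w"
    using hom_mult[of "[a]" w] w x a by simp
  moreover have "inv\<^bsub>free_group S\<^esub> [(x, True)] = [(x, False)]"
    using inv_free_group[of "[(x, True)]" S] x by (simp add: reduce_def word_inv_def)
  then have "cls [(x, False)] = inv\<^bsub>presentation S R\<^esub> gen S R x"
    using hom_inv[of "[(x, True)]"] x by (simp add: gen_def)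
  then have "cls [a] = (if b then gen S R x else inv\<^bsub>presentation S R\<^esub> gen S R x)"
    using a by (simp add: gen_def)
  ultimately show ?case using Cons.IH[OF w] a by simp
qed

lemma relator_trivial:
  assumes "r \<in> R"
  shows "P.word_val (gen S R) r = \<one>\<^bsub>presentation S R\<^esub>"
proof -
  have "reduce ([] @ r @ word_inv []) \<in> normal_closure S R"
    unfolding normal_closure_def using assms
    by (intro generate.incl CollectI exI[of _ "[]"] exI[of _ r]) auto
  then have "reduce r \<in> normal_closure S R" by (simp add: word_inv_def)
  then have "cls (reduce r) = \<one>\<^bsub>presentation S R\<^esub>"
    using rcos_const[OF group_free_group] by (simp add: presentation_def FactGroup_def)
  moreover have "cls (reduce r) = P.word_val (gen S R) (reduce r)"
    using relators[OF assms] by (intro cls_eq_word_val reduce_in_free_group) auto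
  ultimately show ?thesis
    using P.word_val_reduce[OF relators[OF assms] gen_Pi] by simp
qed

lemma generate_gen: "generate (presentation S R) (gen S R ` S) = carrier (presentation S R)"
proof
  show "generate (presentation S R) (gen S R ` S) \<subseteq> carrier (presentation S R)"
    using gen_closed by (intro P.generate_incl) auto
  show "carrier (presentation S R) \<subseteq> generate (presentation S R) (gen S R ` S)"
  proof
    fix c assume "c \<in> carrier (presentation S R)"
    then obtain w where w: "w \<in> carrier (free_group S)" "c = cls w"
      by (rule presentation_cases)
    have "P.word_val (gen S R) w \<in> generate (presentation S R) (gen S R ` S)"
      if "fst ` set w \<subseteq> S" for w
      using that
    proof (induction w)
      case (Cons a w)
      then show ?case
        by (cases a) (auto intro!: generate.eng intro: generate.incl generate.inv)
    qed (simp add: generate.one)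
    then show "c \<in> generate (presentation S R) (gen S R ` S)"
      using w cls_eq_word_val[of w] by simp
  qed
qed

text \<open>Von Dyck's theorem. The last conclusion records the value on any reduced representative;
  it serves to identify \<open>FB7_to_Sym7\<close>, which is defined by choosing a
  representative.\<close>

lemma presentation_hom:
  assumes "group G" and \<phi>: "\<phi> \<in> S \<rightarrow> carrier G"
    and rel: "\<And>r. r \<in> R \<Longrightarrow> monoid.word_val G \<phi> r = \<one>\<^bsub>G\<^esub>"
  obtains F where "F \<in> hom (presentation S R) G" "\<And>s. s \<in> S \<Longrightarrow> F (gen S R s) = \<phi> s"
    "\<And>w. w \<in> carrier (free_group S) \<Longrightarrow> F (cls w) = monoid.word_val G \<phi> w"
proof -
  interpret G: group G by fact
  interpret group_hom "free_group S" G "G.word_val \<phi>"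
    using G.word_val_hom[OF \<phi>] by unfold_locales
  have "normal_closure S R \<subseteq> kernel (free_group S) G (G.word_val \<phi>)"
    unfolding normal_closure_def
  proof (rule free.generate_subgroup_incl[OF _ subgroup_kernel], clarify)
    fix g r assume g: "g \<in> carrier (free_group S)" and r: "r \<in> R"
    have 1: "fst ` set g \<subseteq> S" "fst ` set r \<subseteq> S" "fst ` set (word_inv g) \<subseteq> S"
      using g relators[OF r] by (auto simp: fst_set_word_inv)
    have "G.word_val \<phi> (reduce (g @ r @ word_inv g)) = \<one>\<^bsub>G\<^esub>"
      using 1 \<phi> rel[OF r] G.word_val_closed[OF 1(1) \<phi>] G.word_val_append[OF 1(1) _ \<phi>]
        G.word_val_append[OF 1(2,3) \<phi>] G.word_val_word_inv[OF 1(1) \<phi>]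
      by (subst G.word_val_reduce[where S = S]) (simp_all add: image_Un)
    moreover have "reduce (g @ r @ word_inv g) \<in> carrier (free_group S)"
      using 1 by (intro reduce_in_free_group) auto
    ultimately show "reduce (g @ r @ word_inv g) \<in> kernel (free_group S) G (G.word_val \<phi>)"
      by (simp add: kernel_def)
  qed
  from FactGroup_universal_kernel[OF normal_axioms this] obtain F where
    F: "F \<in> hom (free_group S Mod normal_closure S R) G"
       "\<And>w. w \<in> carrier (free_group S) \<Longrightarrow> F (cls w) = G.word_val \<phi> w" by blast
  show thesis
  proof (rule that[OF _ _ F(2)])
    show "F \<in> hom (presentation S R) G" using F(1) by (simp add: presentation_def)
    show "F (gen S R s) = \<phi> s" if "s \<in> S" for s
      using F(2)[of "[(s, True)]"] that funcset_mem[OF \<phi> that]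
      by (simp add: gen_def)
  qed
qed

end

lemma (in presented) group_presentation: "group (presentation S R)"
  by (rule P.is_group)

lemma (in group_hom) hom_eq_on_generate:
  assumes "f \<in> hom G H" "A \<subseteq> carrier G" "\<And>a. a \<in> A \<Longrightarrow> f a = h a" "x \<in> generate G A"
  shows "f x = h x"
proof -
  interpret f: group_hom G H f using assms(1) by unfold_locales
  from assms(4) show ?thesis
  proof (induction x rule: generate.induct)
    case (eng a b)
    then have "a \<in> carrier G" "b \<in> carrier G"
      using G.generate_in_carrier[OF assms(2)] by auto
    with eng show ?case by simp
  next
    case (inv a)
    then show ?case using assms(2,3) f.hom_inv hom_inv by (metis subsetD)
  qed (use assms in auto)
qed

subsection \<open>Commuting independent pairs\<close>

lemma finite_orbit_support:
  fixes a :: "'x \<Rightarrow> int"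
  assumes "finite {x. a x \<noteq> 0}" "inj (\<lambda>k. (T ^^ k) p)"
  obtains K where "\<And>k. k \<ge> K \<Longrightarrow> a ((T ^^ k) p) = (0::int)"
proof -
  have "finite ((\<lambda>k. (T ^^ k) p) -` {x. a x \<noteq> 0})"
    using assms by (intro finite_vimageI)
  then obtain K where "(\<lambda>k. (T ^^ k) p) -` {x. a x \<noteq> 0} \<subseteq> {..<K}"
    using finite_nat_iff_bounded by blast
  then show thesis by (intro that[of K]) force
qed

text \<open>A vanishing statement for first cohomology of a free rank-two action with finitely
  supported coefficients. Summing \<open>a\<close> along forward \<open>T\<close>-rays solves the
  first equation, and the cocycle identity telescopes to the second. One direction alone would not
  make \<open>m\<close> finitely supported: a point of its support has a forward
  \<open>T\<close>-translate in the support of \<open>a\<close> and a forward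
  \<open>U\<close>-translate in that of \<open>b\<close>, and by freeness these two points determine
  it.\<close>

lemma free_commuting_coboundary:
  fixes a b :: "'x \<Rightarrow> int"
  assumes T: "\<And>p. p \<in> P \<Longrightarrow> T p \<in> P" and U: "\<And>p. p \<in> P \<Longrightarrow> U p \<in> P"
    and comm: "\<And>p. p \<in> P \<Longrightarrow> T (U p) = U (T p)" and inj: "inj_on T P"
    and free: "\<And>p i j i' j'. p \<in> P \<Longrightarrow> (T ^^ i) ((U ^^ j) p) = (T ^^ i') ((U ^^ j') p) \<Longrightarrow> i = i' \<and> j = j'"
    and fin: "finite {x. a x \<noteq> 0}" "finite {x. b x \<noteq> 0}"
    and cocycle: "\<And>p. p \<in> P \<Longrightarrow> a (U p) - a p = b (T p) - b p"
  obtains m where "finite {x. m x \<noteq> 0}" "\<And>x. x \<notin> P \<Longrightarrow> m x = 0"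
    "\<And>p. p \<in> P \<Longrightarrow> a p = m (T p) - m p" "\<And>p. p \<in> P \<Longrightarrow> b p = m (U p) - m p"
proof -
  have Tk: "(T ^^ k) p \<in> P" and Uk: "(U ^^ k) p \<in> P" if "p \<in> P" for k p
    using that T U by (induction k) auto
  have UTk: "U ((T ^^ k) p) = (T ^^ k) (U p)" if "p \<in> P" for k p
    using that by (induction k) (auto simp: comm[symmetric] Tk)
  have comm_pow: "(U ^^ j) ((T ^^ k) p) = (T ^^ k) ((U ^^ j) p)" if "p \<in> P" for j k p
    using that by (induction j) (auto simp: UTk Uk)
  have inj_pow: "inj_on (T ^^ k) P" for k
  proof (induction k)
    case (Suc k)
    then show ?case using inj Tk by (auto simp: inj_on_def)
  qed simp
  have injT: "inj (\<lambda>k. (T ^^ k) p)" if "p \<in> P" for p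
    using free[OF that, of _ 0 _ 0] by (auto intro: injI)
  have injU: "inj (\<lambda>k. (U ^^ k) p)" if "p \<in> P" for p
    using free[OF that, of 0 _ 0] by (auto intro: injI)
  \<comment> \<open>the formal solution \<open>m = - (\<Sum>k. a \<circ> T ^^ k)\<close> of the first equation\<close>
  define m where "m p = (if p \<in> P then - (\<Sum>k | a ((T ^^ k) p) \<noteq> 0. a ((T ^^ k) p)) else 0)" for p
  have m: "m p = - (\<Sum>k<K. a ((T ^^ k) p))"
    if "p \<in> P" "\<And>k. k \<ge> K \<Longrightarrow> a ((T ^^ k) p) = 0" for p K
  proof -
    have "{k. a ((T ^^ k) p) \<noteq> 0} \<subseteq> {..<K}" using that(2) by (auto simp: not_le[symmetric])
    then have "(\<Sum>k | a ((T ^^ k) p) \<noteq> 0. a ((T ^^ k) p)) = (\<Sum>k<K. a ((T ^^ k) p))"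
      by (intro sum.mono_neutral_left) auto
    then show ?thesis using that(1) by (simp add: m_def)
  qed
  have ma: "a p = m (T p) - m p" if p: "p \<in> P" for p
  proof -
    obtain K where K: "\<And>k. k \<ge> K \<Longrightarrow> a ((T ^^ k) p) = 0"
      using finite_orbit_support[OF fin(1) injT[OF p]] by blast
    have "m (T p) = - (\<Sum>k<K. a ((T ^^ Suc k) p))"
      using K[of "Suc _"] by (subst m[of "T p" K]) (simp_all add: T p funpow_swap1)
    moreover have "m p = - (\<Sum>k<Suc K. a ((T ^^ k) p))" using K by (intro m p) auto
    ultimately show ?thesis by (simp add: sum.lessThan_Suc_shift del: sum.lessThan_Suc)
  qed
  have mb: "b p = m (U p) - m p" if p: "p \<in> P" for p
  proof -
    obtain K1 where K1: "\<And>k. k \<ge> K1 \<Longrightarrow> a ((T ^^ k) p) = 0"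
      using finite_orbit_support[OF fin(1) injT[OF p]] by blast
    obtain K2 where K2: "\<And>k. k \<ge> K2 \<Longrightarrow> a ((T ^^ k) (U p)) = 0"
      using finite_orbit_support[OF fin(1) injT[OF U[OF p]]] by blast
    obtain K3 where K3: "\<And>k. k \<ge> K3 \<Longrightarrow> b ((T ^^ k) p) = 0"
      using finite_orbit_support[OF fin(2) injT[OF p]] by blast
    define K where "K = max K1 (max K2 K3)"
    have "m (U p) - m p = - (\<Sum>k<K. a (U ((T ^^ k) p)) - a ((T ^^ k) p))"
      using K1 K2 by (subst (1 2) m[of _ K]) (auto simp: K_def p U UTk sum_subtractf)
    also have "\<dots> = - (\<Sum>k<K. b ((T ^^ Suc k) p) - b ((T ^^ k) p))"
      by (simp add: cocycle[OF Tk[OF p]])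
    also have "\<dots> = b p - b ((T ^^ K) p)" by (subst sum_lessThan_telescope) simp
    also have "\<dots> = b p" using K3 by (simp add: K_def)
    finally show ?thesis ..
  qed
  have nza: "\<exists>k. a ((T ^^ k) p) \<noteq> 0" if "m p \<noteq> 0" for p
  proof (rule ccontr)
    assume "\<not> ?thesis"
    then show False using m[of p 0] that by (cases "p \<in> P") (auto simp: m_def)
  qed
  \<comment> \<open>Otherwise \<open>m\<close> is constant along the forward \<open>U\<close>-orbit
    of \<open>p\<close>, so the \<open>T\<close>-ray from each of its points meets the support of
    \<open>a\<close>; by freeness these are infinitely many distinct points.\<close>
  have nzb: "\<exists>k. b ((U ^^ k) p) \<noteq> 0" if "m p \<noteq> 0" "p \<in> P" for p
  proof (rule ccontr)
    assume "\<not> ?thesis"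
    then have "m ((U ^^ j) p) = m p" for j
      using mb[OF Uk[OF that(2)]] by (induction j) force+
    then have "\<forall>j. \<exists>k. a ((T ^^ k) ((U ^^ j) p)) \<noteq> 0" using nza that by simp
    then obtain k where k: "\<And>j. a ((T ^^ k j) ((U ^^ j) p)) \<noteq> 0" by metis
    have "inj (\<lambda>j. (T ^^ k j) ((U ^^ j) p))"
      using free[OF that(2)] by (auto intro: injI)
    then have "infinite (range (\<lambda>j. (T ^^ k j) ((U ^^ j) p)))"
      using finite_imageD infinite_UNIV_nat by blast
    moreover have "range (\<lambda>j. (T ^^ k j) ((U ^^ j) p)) \<subseteq> {x. a x \<noteq> 0}" using k by auto
    ultimately show False using fin(1) finite_subset by blast
  qed
  have "finite {x. m x \<noteq> 0}"
  proof -
    have "\<exists>k l. a ((T ^^ k) p) \<noteq> 0 \<and> b ((U ^^ l) p) \<noteq> 0" if "m p \<noteq> 0" for p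
      using nza[OF that] nzb[OF that] that by (cases "p \<in> P") (auto simp: m_def)
    then obtain k l where kl: "\<And>p. m p \<noteq> 0 \<Longrightarrow> a ((T ^^ k p) p) \<noteq> 0 \<and> b ((U ^^ l p) p) \<noteq> 0"
      by metis
    \<comment> \<open>If two points \<open>p\<close>, \<open>q\<close> give the same pair, both
      exponent pairs can be compared on the orbit of \<open>q\<close>; freeness makes them equal,
      and injectivity of \<open>T ^^ k\<close> gives \<open>p = q\<close>.\<close>
    have "inj_on (\<lambda>p. ((T ^^ k p) p, (U ^^ l p) p)) {x. m x \<noteq> 0}"
    proof (rule inj_onI, clarsimp)
      fix p q assume "m p \<noteq> 0" "m q \<noteq> 0"
      then have pq: "p \<in> P" "q \<in> P" by (auto simp: m_def split: if_splits)
      assume 1: "(T ^^ k p) p = (T ^^ k q) q" and 2: "(U ^^ l p) p = (U ^^ l q) q"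
      have "(T ^^ k q) ((U ^^ l p) q) = (U ^^ l p) ((T ^^ k p) p)"
        using 1 pq by (simp add: comm_pow)
      also have "\<dots> = (T ^^ k p) ((U ^^ l q) q)" using 2 pq by (simp add: comm_pow)
      finally have "k q = k p \<and> l p = l q" using free pq by blast
      then show "p = q" using 1 inj_pow pq by (metis inj_onD)
    qed
    moreover have "(\<lambda>p. ((T ^^ k p) p, (U ^^ l p) p)) ` {x. m x \<noteq> 0} \<subseteq> {x. a x \<noteq> 0} \<times> {x. b x \<noteq> 0}"
      using kl by auto
    ultimately show ?thesis using fin by (meson finite_SigmaI inj_on_finite)
  qed
  then show thesis using that ma mb by (simp add: m_def)
qed

section \<open>Powers, finite index and independence\<close>

lemma (in group) pow_commutes:
  assumes "x \<in> carrier G" "y \<in> carrier G" "x \<otimes> y = y \<otimes> x"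
  shows "x [^] (n::nat) \<otimes> y = y \<otimes> x [^] n"
proof (induction n)
  case (Suc n)
  have "x [^] Suc n \<otimes> y = x [^] n \<otimes> (x \<otimes> y)" using assms by (simp add: m_assoc)
  also have "\<dots> = (x [^] n \<otimes> y) \<otimes> x" using assms by (simp add: m_assoc)
  also have "\<dots> = y \<otimes> x [^] Suc n" using assms Suc by (simp add: m_assoc)
  finally show ?case .
qed (use assms in simp)

lemma (in group) pow_conj:
  assumes "g \<in> carrier G" "x \<in> carrier G"
  shows "(g \<otimes> x \<otimes> inv g) [^] (n::nat) = g \<otimes> x [^] n \<otimes> inv g"
proof (induction n)
  case (Suc n)
  then have "(g \<otimes> x \<otimes> inv g) [^] Suc n = g \<otimes> x [^] n \<otimes> (inv g \<otimes> g) \<otimes> x \<otimes> inv g"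
    using assms by (simp only: nat_pow_Suc m_assoc m_closed inv_closed nat_pow_closed)
  then show ?case using assms by (simp add: m_assoc)
qed (use assms in simp)

lemma (in group) pow_finite_rcosets:
  assumes "subgroup H G" "finite (rcosets H)"
  obtains n where "n > (0::nat)" "\<And>g. g \<in> carrier G \<Longrightarrow> g [^] n \<in> H"
proof -
  let ?k = "card (rcosets H)"
  have "\<exists>j. 0 < j \<and> j \<le> ?k \<and> g [^] j \<in> H" if g: "g \<in> carrier G" for g
  proof -
    have "(\<lambda>i. H #> g [^] i) ` {..?k} \<subseteq> rcosets H"
      using g by (auto simp: RCOSETS_def)
    then have "card ((\<lambda>i. H #> g [^] i) ` {..?k}) \<le> ?k" by (rule card_mono[OF assms(2)])
    \<comment> \<open>\<open>{..?k}\<close> has \<open>?k + 1\<close> elements, one more than there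
      are cosets.\<close>
    then have "\<not> inj_on (\<lambda>i. H #> g [^] i) {..?k}" using card_image by fastforce
    then obtain i j where ij: "i < j" "j \<le> ?k" "H #> g [^] i = H #> g [^] j"
      by (auto simp: inj_on_def) (metis linorder_neqE_nat)
    have "g [^] j = g [^] (j - i) \<otimes> g [^] i" using g ij(1) by (simp add: nat_pow_mult)
    moreover have "g [^] j \<in> H #> g [^] i"
      unfolding ij(3) using g assms(1) by (intro rcos_self) auto
    then have "g [^] j \<otimes> inv (g [^] i) \<in> H"
      using g assms(1) by (intro subgroup.rcos_module_imp[OF _ is_group]) auto
    ultimately have "g [^] (j - i) \<in> H" using g by (simp add: m_assoc)
    then show ?thesis using ij by (intro exI[of _ "j - i"]) auto
  qed
  then obtain j where j: "\<And>g. g \<in> carrier G \<Longrightarrow> 0 < j g \<and> j g \<le> ?k \<and> g [^] j g \<in> H" by metis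
  have "g [^] (fact ?k :: nat) \<in> H" if "g \<in> carrier G" for g
  proof -
    have "j g dvd fact ?k" using j[OF that] by (intro dvd_fact) auto
    then obtain l where "fact ?k = j g * l" by (elim dvdE)
    then have "g [^] (fact ?k :: nat) = (g [^] j g) [^] l" using that by (simp add: nat_pow_pow)
    moreover have "h [^] l \<in> H" if "h \<in> H" for h
      using that assms(1) by (induction l) (auto intro: subgroup.m_closed subgroup.one_closed)
    ultimately show ?thesis using j[OF that] by metis
  qed
  then show thesis by (intro that[of "fact ?k"]) auto
qed

text \<open>For commuting \<open>u\<close>, \<open>v\<close> in a group this says that they freely
  generate a free abelian group of rank two: natural exponents suffice because negative ones can be
  moved to the other side.\<close>

definition (in monoid) independent :: "'a \<Rightarrow> 'a \<Rightarrow> bool" where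
  "independent u v \<longleftrightarrow>
     (\<forall>i j i' j'. u [^] (i::nat) \<otimes> v [^] (j::nat) = u [^] (i'::nat) \<otimes> v [^] (j'::nat) \<longrightarrow> i = i' \<and> j = j')"

text \<open>Translating a chain by \<open>u\<close> evaluates it at \<open>u^-1\<close>-translates,
  so freeness is required of the inverses.\<close>

lemma (in group) independent_inv:
  assumes "u \<in> carrier G" "v \<in> carrier G" "u \<otimes> v = v \<otimes> u" "independent u v"
  shows "independent (inv u) (inv v)"
  unfolding independent_def
proof (intro allI impI)
  fix i j i' j' :: nat
  have comm: "u [^] a \<otimes> v [^] b = v [^] b \<otimes> u [^] a" for a b :: nat
    using assms by (intro pow_commutes pow_commutes[symmetric]) auto
  have eq: "inv u [^] a \<otimes> inv v [^] b = inv (u [^] a \<otimes> v [^] b)" for a b :: nat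
    using assms by (simp add: comm inv_mult_group nat_pow_inv)
  assume "inv u [^] i \<otimes> inv v [^] j = inv u [^] i' \<otimes> inv v [^] j'"
  then have "u [^] i \<otimes> v [^] j = u [^] i' \<otimes> v [^] j'"
    unfolding eq using assms by (simp add: inj_on_eq_iff[OF inv_inj])
  then show "i = i' \<and> j = j'" using assms(4) by (auto simp: independent_def)
qed

lemma (in group_hom) independent_preimage:
  assumes "u \<in> carrier G" "v \<in> carrier G" "H.independent (h u) (h v)"
  shows "G.independent u v"
  unfolding G.independent_def
proof (intro allI impI)
  fix i j i' j' :: nat
  assume "u [^] i \<otimes> v [^] j = u [^] i' \<otimes> v [^] j'"
  then have "h (u [^] i \<otimes> v [^] j) = h (u [^] i' \<otimes> v [^] j')" by simp
  then show "i = i' \<and> j = j'"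
    using assms by (simp add: hom_nat_pow H.independent_def)
qed

lemma (in group) independent_pow_neq_one:
  assumes "independent u v" "u \<in> carrier G" "v \<in> carrier G" "n > 0"
  shows "u [^] (n::nat) \<noteq> \<one>" "v [^] n \<noteq> \<one>"
proof -
  have "u [^] i \<otimes> v [^] j = u [^] (0::nat) \<otimes> v [^] (0::nat) \<Longrightarrow> i = 0 \<and> j = 0" for i j :: nat
    using assms(1) unfolding independent_def by blast
  from this[of n 0] this[of 0 n] show "u [^] n \<noteq> \<one>" "v [^] n \<noteq> \<one>"
    using assms(2-4) by auto
qed

lemma (in group) independent_conj:
  assumes "independent u v" "u \<in> carrier G" "v \<in> carrier G" "g \<in> carrier G"
  shows "independent (g \<otimes> u \<otimes> inv g) (g \<otimes> v \<otimes> inv g)"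
  unfolding independent_def
proof (intro allI impI)
  fix i j i' j' :: nat
  have eq: "(g \<otimes> u \<otimes> inv g) [^] a \<otimes> (g \<otimes> v \<otimes> inv g) [^] b = g \<otimes> (u [^] a \<otimes> v [^] b) \<otimes> inv g" for a b :: nat
  proof -
    have "(g \<otimes> u \<otimes> inv g) [^] a \<otimes> (g \<otimes> v \<otimes> inv g) [^] b = g \<otimes> u [^] a \<otimes> (inv g \<otimes> g) \<otimes> v [^] b \<otimes> inv g"
      unfolding pow_conj[OF assms(4,2)] pow_conj[OF assms(4,3)]
      using assms by (simp only: m_assoc m_closed inv_closed nat_pow_closed)
    then show ?thesis using assms by (simp add: m_assoc)
  qed
  assume "(g \<otimes> u \<otimes> inv g) [^] i \<otimes> (g \<otimes> v \<otimes> inv g) [^] j = (g \<otimes> u \<otimes> inv g) [^] i' \<otimes> (g \<otimes> v \<otimes> inv g) [^] j'"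
  then have "u [^] i \<otimes> v [^] j = u [^] i' \<otimes> v [^] j'"
    unfolding eq using assms by simp
  then show "i = i' \<and> j = j'" using assms(1) by (auto simp: independent_def)
qed

subsection \<open>Chains on a G-set and derivations\<close>

locale gset = group G for G (structure) +
  fixes Y :: "'x set" and act :: "'a \<Rightarrow> 'x \<Rightarrow> 'x"
  assumes act_closed [simp]: "g \<in> carrier G \<Longrightarrow> x \<in> Y \<Longrightarrow> act g x \<in> Y"
    and act_one [simp]: "x \<in> Y \<Longrightarrow> act \<one> x = x"
    and act_mult: "g \<in> carrier G \<Longrightarrow> h \<in> carrier G \<Longrightarrow> x \<in> Y \<Longrightarrow> act (g \<otimes> h) x = act g (act h x)"
begin

lemma act_inv [simp]:
  assumes "g \<in> carrier G" "x \<in> Y"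
  shows "act g (act (inv g) x) = x" "act (inv g) (act g x) = x"
  using assms by (simp_all add: act_mult[symmetric])

lemma act_pow: "g \<in> carrier G \<Longrightarrow> x \<in> Y \<Longrightarrow> act (g [^] (n::nat)) x = (act g ^^ n) x"
proof (induction n)
  case (Suc n)
  then have "act (g [^] Suc n) x = act (g \<otimes> g [^] n) x" by (simp only: nat_pow_Suc2)
  with Suc show ?case by (simp add: act_mult)
qed simp

text \<open>The permutation module Z[Y], with \<open>shift\<close> as its left translation.
  Everything is pinned to 0 outside \<open>Y\<close>, where \<open>act\<close> is unspecified, so
  that equality of chains is equality of functions.\<close>

definition chains :: "('x \<Rightarrow> int) set" where
  "chains = {m. finite {x. m x \<noteq> 0} \<and> (\<forall>x. x \<notin> Y \<longrightarrow> m x = 0)}"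

definition shift :: "'a \<Rightarrow> ('x \<Rightarrow> int) \<Rightarrow> 'x \<Rightarrow> int" where
  "shift g m = (\<lambda>x. if x \<in> Y then m (act (inv g) x) else 0)"

lemma chainsD: "m \<in> chains \<Longrightarrow> finite {x. m x \<noteq> 0}" "m \<in> chains \<Longrightarrow> x \<notin> Y \<Longrightarrow> m x = 0"
  by (auto simp: chains_def)

lemma zero_chain: "(\<lambda>_. 0) \<in> chains"
  by (simp add: chains_def)

lemma add_chain: "m \<in> chains \<Longrightarrow> n \<in> chains \<Longrightarrow> (\<lambda>x. m x + n x) \<in> chains"
  by (auto simp: chains_def intro: finite_subset[where B = "{x. m x \<noteq> 0} \<union> {x. n x \<noteq> 0}"])

lemma uminus_chain: "m \<in> chains \<Longrightarrow> (\<lambda>x. - m x) \<in> chains"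
  by (simp add: chains_def)

lemma diff_chain: "m \<in> chains \<Longrightarrow> n \<in> chains \<Longrightarrow> (\<lambda>x. m x - n x) \<in> chains"
  using add_chain[OF _ uminus_chain] by simp

lemma shift_chain: "g \<in> carrier G \<Longrightarrow> m \<in> chains \<Longrightarrow> shift g m \<in> chains"
proof -
  assume g: "g \<in> carrier G" and m: "m \<in> chains"
  have "{x. shift g m x \<noteq> 0} \<subseteq> act g ` {x. m x \<noteq> 0}"
  proof
    fix x assume "x \<in> {x. shift g m x \<noteq> 0}"
    then have "x \<in> Y" "m (act (inv g) x) \<noteq> 0" by (auto simp: shift_def split: if_splits)
    then show "x \<in> act g ` {x. m x \<noteq> 0}"
      using g by (intro image_eqI[of _ _ "act (inv g) x"]) auto
  qed
  then have "finite {x. shift g m x \<noteq> 0}"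
    using chainsD(1)[OF m] finite_surj by blast
  then show ?thesis by (simp add: chains_def shift_def)
qed

lemma shift_mult:
  "g \<in> carrier G \<Longrightarrow> h \<in> carrier G \<Longrightarrow> shift (g \<otimes> h) m = shift g (shift h m)"
  by (auto simp: shift_def inv_mult_group act_mult)

lemma shift_one: "m \<in> chains \<Longrightarrow> shift \<one> m = m"
  by (auto simp: shift_def chains_def)

lemma shift_add: "shift g (\<lambda>x. m x + n x) = (\<lambda>x. shift g m x + shift g n x)"
  by (auto simp: shift_def)

lemma shift_diff: "shift g (\<lambda>x. m x - n x) = (\<lambda>x. shift g m x - shift g n x)"
  by (auto simp: shift_def)

lemma shift_zero [simp]: "shift g (\<lambda>_. 0) = (\<lambda>_. 0)"
  by (auto simp: shift_def)

lemma shift_act: "g \<in> carrier G \<Longrightarrow> x \<in> Y \<Longrightarrow> shift g m (act g x) = m x"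
  by (simp add: shift_def)

text \<open>The forward orbit of \<open>x\<close> under \<open>z\<close> stays inside the finite
  support of \<open>m\<close>, so two of its points coincide.\<close>

lemma invariant_chain_periodic:
  assumes m: "m \<in> chains" and z: "z \<in> carrier G" "shift z m = m" and x: "m x \<noteq> 0"
  obtains n where "n > (0::nat)" "act (z [^] n) x = x"
proof -
  have Y: "x \<in> Y" using chainsD(2)[OF m] x by blast
  have "m (act (z [^] k) x) = m x" for k :: nat
  proof (induction k)
    case (Suc k)
    have "act (z [^] Suc k) x = act z (act (z [^] k) x)"
      using z Y by (simp only: nat_pow_Suc2 act_mult nat_pow_closed)
    then show ?case
      using Suc shift_act[OF z(1), of "act (z [^] k) x" m] z Y by (metis act_closed nat_pow_closed)
  qed (use Y in simp)
  then have "range (\<lambda>k::nat. act (z [^] k) x) \<subseteq> {x. m x \<noteq> 0}" using x by auto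
  then have "\<not> inj (\<lambda>k::nat. act (z [^] k) x)"
    using chainsD(1)[OF m] finite_subset finite_imageD infinite_UNIV_nat by metis
  then obtain i j where ij: "i < j" "act (z [^] i) x = act (z [^] (j::nat)) x"
    by (auto simp: inj_on_def) (metis linorder_neqE_nat)
  have "z [^] j = z [^] i \<otimes> z [^] (j - i)" using z ij(1) by (simp add: nat_pow_mult)
  then have "act (z [^] i) x = act (z [^] i) (act (z [^] (j - i)) x)"
    using ij(2) z Y by (simp add: act_mult)
  then have "act (inv (z [^] i)) (act (z [^] i) x)
      = act (inv (z [^] i)) (act (z [^] i) (act (z [^] (j - i)) x))" by simp
  then show thesis using that[of "j - i"] ij(1) z Y by simp
qed

text \<open>Crossed homomorphisms, that is 1-cocycles with values in Z[Y].\<close>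

definition derivation :: "('a \<Rightarrow> 'x \<Rightarrow> int) \<Rightarrow> bool" where
  "derivation D \<longleftrightarrow> D \<in> carrier G \<rightarrow> chains \<and>
     (\<forall>g\<in>carrier G. \<forall>h\<in>carrier G. D (g \<otimes> h) = (\<lambda>x. D g x + shift g (D h) x))"

lemma derivation_mult:
  "derivation D \<Longrightarrow> g \<in> carrier G \<Longrightarrow> h \<in> carrier G \<Longrightarrow> D (g \<otimes> h) = (\<lambda>x. D g x + shift g (D h) x)"
  by (simp add: derivation_def)

lemma derivation_chain: "derivation D \<Longrightarrow> g \<in> carrier G \<Longrightarrow> D g \<in> chains"
  by (auto simp: derivation_def)

lemma derivation_one: "derivation D \<Longrightarrow> D \<one> = (\<lambda>_. 0)"
  using derivation_mult[of D \<one> \<one>] derivation_chain[of D \<one>]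
  by (auto simp: shift_one fun_eq_iff)

text \<open>Expanding \<open>D\<close> on both sides of \<open>u v = v u\<close> gives exactly the
  cocycle identity of \<open>free_commuting_coboundary\<close>, with the inverses of
  \<open>u\<close> and \<open>v\<close> as the two maps.\<close>

lemma derivation_inner_on_free_pair:
  assumes D: "derivation D" and uv: "u \<in> carrier G" "v \<in> carrier G" "u \<otimes> v = v \<otimes> u"
    and free: "\<And>x i j i' j'. x \<in> Y \<Longrightarrow> act (inv u [^] (i::nat) \<otimes> inv v [^] (j::nat)) x
                 = act (inv u [^] (i'::nat) \<otimes> inv v [^] (j'::nat)) x \<Longrightarrow> i = i' \<and> j = j'"
  obtains m where "m \<in> chains" "D u = (\<lambda>x. shift u m x - m x)" "D v = (\<lambda>x. shift v m x - m x)"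
proof (rule free_commuting_coboundary[of Y "act (inv u)" "act (inv v)" "D u" "D v"])
  fix x assume x: "x \<in> Y"
  have "inv u \<otimes> inv v = inv v \<otimes> inv u" using uv by (simp add: inv_mult_group[symmetric])
  then show "act (inv u) (act (inv v) x) = act (inv v) (act (inv u) x)"
    using uv x by (simp add: act_mult[symmetric])
  have "D u x + shift u (D v) x = D v x + shift v (D u) x"
    using derivation_mult[OF D uv(1,2)] derivation_mult[OF D uv(2,1)] uv(3) by metis
  then show "D u (act (inv v) x) - D u x = D v (act (inv u) x) - D v x"
    using x by (simp add: shift_def)
next
  fix x i j i' j'
  assume x: "x \<in> Y" and eq: "(act (inv u) ^^ i) ((act (inv v) ^^ j) x) = (act (inv u) ^^ i') ((act (inv v) ^^ j') x)"
  have "act (inv u [^] a \<otimes> inv v [^] b) x = (act (inv u) ^^ a) ((act (inv v) ^^ b) x)" for a b :: nat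
    using x uv by (simp add: act_mult act_pow[symmetric])
  then show "i = i' \<and> j = j'" using free[OF x] eq by metis
next
  show "inj_on (act (inv u)) Y" using uv by (metis act_inv(1) inj_onI)
next
  fix m assume m: "finite {x. m x \<noteq> 0}" "\<And>x. x \<notin> Y \<Longrightarrow> m x = 0"
    "\<And>x. x \<in> Y \<Longrightarrow> D u x = m (act (inv u) x) - m x" "\<And>x. x \<in> Y \<Longrightarrow> D v x = m (act (inv v) x) - m x"
  have "D g = (\<lambda>x. shift g m x - m x)"
    if "g \<in> carrier G" "\<And>x. x \<in> Y \<Longrightarrow> D g x = m (act (inv g) x) - m x" for g
  proof
    fix x show "D g x = shift g m x - m x"
      using that m(2) chainsD(2)[OF derivation_chain[OF D that(1)]]
      by (cases "x \<in> Y") (auto simp: shift_def)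
  qed
  then show thesis using that[of m] m uv by (auto simp: chains_def)
qed (use uv D derivation_chain chainsD in auto)

text \<open>The function \<omega> may have infinite support: the constant 1 gives the augmentation,
  and a weight on orbits of edges gives a signed crossing count.\<close>

definition pair :: "('x \<Rightarrow> int) \<Rightarrow> ('x \<Rightarrow> int) \<Rightarrow> int" where
  "pair \<omega> m = (\<Sum>x | m x \<noteq> 0. \<omega> x * m x)"

lemma pair_superset: "finite A \<Longrightarrow> {x. m x \<noteq> 0} \<subseteq> A \<Longrightarrow> pair \<omega> m = (\<Sum>x\<in>A. \<omega> x * m x)"
  unfolding pair_def by (rule sum.mono_neutral_left) auto

lemma pair_add:
  assumes "m \<in> chains" "n \<in> chains"
  shows "pair \<omega> (\<lambda>x. m x + n x) = pair \<omega> m + pair \<omega> n"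
proof -
  let ?A = "{x. m x \<noteq> 0} \<union> {x. n x \<noteq> 0}"
  have "finite ?A" using assms by (auto simp: chains_def)
  then show ?thesis
    by (subst (1 2 3) pair_superset[of ?A]) (auto simp: sum.distrib distrib_left)
qed

lemma pair_diff:
  assumes "m \<in> chains" "n \<in> chains"
  shows "pair \<omega> (\<lambda>x. m x - n x) = pair \<omega> m - pair \<omega> n"
  using pair_add[OF diff_chain[OF assms] assms(2), of \<omega>] by simp

lemma pair_shift:
  assumes "g \<in> carrier G" "m \<in> chains"
  shows "pair \<omega> (shift g m) = pair (\<lambda>x. \<omega> (act g x)) m"
  unfolding pair_def
proof (rule sum.reindex_bij_witness[of _ "act g" "act (inv g)"])
  fix x assume "x \<in> {x. shift g m x \<noteq> 0}"
  then have "x \<in> Y" "m (act (inv g) x) \<noteq> 0" by (auto simp: shift_def split: if_splits)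
  then show "act g (act (inv g) x) = x" "act (inv g) x \<in> {x. m x \<noteq> 0}"
    "\<omega> (act g (act (inv g) x)) * m (act (inv g) x) = \<omega> x * shift g m x"
    using assms(1) by (simp_all add: shift_def)
next
  fix x assume "x \<in> {x. m x \<noteq> 0}"
  moreover from this have "x \<in> Y" using chainsD(2)[OF assms(2)] by blast
  ultimately show "act (inv g) (act g x) = x" "act g x \<in> {x. shift g m x \<noteq> 0}"
    using assms(1) by (simp_all add: shift_act)
qed

lemma pair_cong: "m \<in> chains \<Longrightarrow> (\<And>x. x \<in> Y \<Longrightarrow> \<omega> x = \<omega>' x) \<Longrightarrow> pair \<omega> m = pair \<omega>' m"
  unfolding pair_def by (intro sum.cong) (use chainsD(2) in auto)

text \<open>Derivations \<open>D\<close> correspond to homomorphisms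
  \<open>g \<mapsto> (g, D g)\<close> into this group, so von Dyck's theorem produces derivations
  from their values on generators.\<close>

definition semidirect :: "('a \<times> ('x \<Rightarrow> int)) monoid" where
  "semidirect = \<lparr>carrier = carrier G \<times> chains,
     monoid.mult = (\<lambda>(g, m) (h, n). (g \<otimes> h, \<lambda>x. m x + shift g n x)), one = (\<one>, \<lambda>_. 0)\<rparr>"

lemma semidirect_simps [simp]:
  "carrier semidirect = carrier G \<times> chains"
  "(g, m) \<otimes>\<^bsub>semidirect\<^esub> (h, n) = (g \<otimes> h, \<lambda>x. m x + shift g n x)"
  "\<one>\<^bsub>semidirect\<^esub> = (\<one>, \<lambda>_. 0)"
  by (simp_all add: semidirect_def)

lemma group_semidirect: "group semidirect"
proof (rule groupI)
  fix a b c
  assume "a \<in> carrier semidirect" "b \<in> carrier semidirect" "c \<in> carrier semidirect"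
  then show "a \<otimes>\<^bsub>semidirect\<^esub> b \<otimes>\<^bsub>semidirect\<^esub> c = a \<otimes>\<^bsub>semidirect\<^esub> (b \<otimes>\<^bsub>semidirect\<^esub> c)"
    by (cases a; cases b; cases c) (simp add: m_assoc shift_mult shift_add add.assoc)
next
  fix a assume a: "a \<in> carrier semidirect"
  obtain g m where gm: "a = (g, m)" by force
  have "(inv g, \<lambda>x. - shift (inv g) m x) \<otimes>\<^bsub>semidirect\<^esub> a = \<one>\<^bsub>semidirect\<^esub>"
    using a gm by simp
  moreover have "(inv g, \<lambda>x. - shift (inv g) m x) \<in> carrier semidirect"
    using a gm by (simp add: uminus_chain shift_chain)
  ultimately show "\<exists>b\<in>carrier semidirect. b \<otimes>\<^bsub>semidirect\<^esub> a = \<one>\<^bsub>semidirect\<^esub>" by blast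
qed (auto simp: zero_chain add_chain shift_chain shift_one)

end

lemma (in gset) periodic_free_chain_zero:
  assumes m: "m \<in> chains" "shift z m = m" and z: "z \<in> carrier G"
    and free: "\<And>x n. x \<in> Y \<Longrightarrow> n > (0::nat) \<Longrightarrow> act (z [^] n) x \<noteq> x"
  shows "m = (\<lambda>_. 0)"
proof
  fix x
  show "m x = 0"
    using invariant_chain_periodic[OF m(1) z m(2), of x] free chainsD(2)[OF m(1)] by metis
qed

text \<open>The difference of two solutions is \<open>z\<close>-invariant, and a nonzero invariant
  chain would need a periodic point. This uniqueness is what later glues chains together.\<close>

lemma (in gset) inner_chain_unique:
  assumes "m \<in> chains" "m' \<in> chains" and z: "z \<in> carrier G"
    and "(\<lambda>x. shift z m x - m x) = (\<lambda>x. shift z m' x - m' x)"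
    and "\<And>x n. x \<in> Y \<Longrightarrow> n > (0::nat) \<Longrightarrow> act (z [^] n) x \<noteq> x"
  shows "m = m'"
proof -
  have "shift z (\<lambda>x. m x - m' x) = (\<lambda>x. m x - m' x)"
    using assms(4) by (simp add: shift_diff fun_eq_iff algebra_simps)
  then have "(\<lambda>x. m x - m' x) = (\<lambda>_. 0)"
    using assms by (intro periodic_free_chain_zero diff_chain)
  then show ?thesis by (simp add: fun_eq_iff)
qed

text \<open>With \<open>z' = r z r^-1\<close>, expanding \<open>D\<close> on
  \<open>z' r = r z\<close> shows that the error \<open>D r - (shift r m - m)\<close> is invariant
  under \<open>z'\<close>, hence zero.\<close>

lemma (in gset) derivation_inner_conj:
  assumes D: "derivation D" and r: "r \<in> carrier G" and z: "z \<in> carrier G" and m: "m \<in> chains"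
    and Dz: "D z = (\<lambda>x. shift z m x - m x)"
    and Dz': "D (r \<otimes> z \<otimes> inv r) = (\<lambda>x. shift (r \<otimes> z \<otimes> inv r) m x - m x)"
    and free: "\<And>x n. x \<in> Y \<Longrightarrow> n > (0::nat) \<Longrightarrow> act ((r \<otimes> z \<otimes> inv r) [^] n) x \<noteq> x"
  shows "D r = (\<lambda>x. shift r m x - m x)"
proof -
  define z' where "z' = r \<otimes> z \<otimes> inv r"
  define c where "c = (\<lambda>x. m x + (D r x - shift r m x))"
  have z': "z' \<in> carrier G" using r z by (simp add: z'_def)
  have eq: "z' \<otimes> r = r \<otimes> z" using r z by (simp add: z'_def m_assoc)
  have "shift z' c = c"
  proof
    fix x
    have "D (z' \<otimes> r) x = D (r \<otimes> z) x" by (simp add: eq)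
    then have "shift z' m x - m x + shift z' (D r) x = D r x + (shift r (shift z m) x - shift r m x)"
      using derivation_mult[OF D z' r] derivation_mult[OF D r z] Dz Dz'[folded z'_def]
      by (simp add: shift_diff)
    moreover have "shift r (shift z m) = shift z' (shift r m)"
      using shift_mult[OF r z] shift_mult[OF z' r] eq by metis
    ultimately show "shift z' c x = c x"
      by (simp add: c_def shift_add shift_diff)
  qed
  moreover have "c \<in> chains"
    unfolding c_def using m r by (intro add_chain diff_chain shift_chain derivation_chain[OF D])
  ultimately have "c = (\<lambda>_. 0)"
    using z' free by (intro periodic_free_chain_zero) (auto simp: z'_def)
  then show ?thesis by (auto simp: c_def fun_eq_iff algebra_simps)
qed

lemma (in group) gset_regular: "gset G (carrier G) (\<otimes>)"
  by unfold_locales (auto simp: m_assoc)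

lemma (in group) gset_lcosets:
  assumes "subgroup K G"
  shows "gset G ((\<lambda>g. g <# K) ` carrier G) (\<lambda>g x. g <# x)"
proof -
  have "g <# (h <# K) = (g \<otimes> h) <# K" if "g \<in> carrier G" "h \<in> carrier G" for g h
    using that subgroup.subset[OF assms] by (intro lcos_m_assoc) auto
  then show ?thesis by unfold_locales (auto simp: m_assoc)
qed

lemma (in group) lcos_eq_iff:
  assumes "subgroup K G" "g \<in> carrier G" "h \<in> carrier G"
  shows "g <# K = h <# K \<longleftrightarrow> inv h \<otimes> g \<in> K"
proof -
  interpret K: subgroup K G by fact
  have "g <# K = h <# K \<longleftrightarrow> g \<in> h <# K"
    using l_repr_independence[of g h K] assms lcos_self[of g K] by auto
  also have "\<dots> \<longleftrightarrow> inv h \<otimes> g \<in> K"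
  proof
    assume "g \<in> h <# K"
    then obtain k where "k \<in> K" "g = h \<otimes> k" by (auto simp: l_coset_def)
    then show "inv h \<otimes> g \<in> K" using assms by (simp add: m_assoc[symmetric])
  next
    assume "inv h \<otimes> g \<in> K"
    moreover have "g = h \<otimes> (inv h \<otimes> g)" using assms by (simp add: m_assoc[symmetric])
    ultimately show "g \<in> h <# K" unfolding l_coset_def by blast
  qed
  finally show ?thesis .
qed

text \<open>Fox calculus: prescribed values on generators extend to a derivation as soon as the
  relators evaluate to the identity of the semidirect product.\<close>

lemma (in presented) presentation_derivation:
  assumes "gset (presentation S R) Y act"
    and d: "d \<in> S \<rightarrow> gset.chains Y"
    and rel: "\<And>r. r \<in> R \<Longrightarrow> monoid.word_val (gset.semidirect (presentation S R) Y act)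
                 (\<lambda>s. (gen S R s, d s)) r = (\<one>\<^bsub>presentation S R\<^esub>, \<lambda>_. 0)"
  obtains D where "gset.derivation (presentation S R) Y act D" "\<And>s. s \<in> S \<Longrightarrow> D (gen S R s) = d s"
proof -
  interpret gset "presentation S R" Y act by fact
  have \<phi>: "(\<lambda>s. (gen S R s, d s)) \<in> S \<rightarrow> carrier semidirect"
    using d gen_closed by auto
  obtain F where F: "F \<in> hom (presentation S R) semidirect"
    "\<And>s. s \<in> S \<Longrightarrow> F (gen S R s) = (gen S R s, d s)"
    by (rule presentation_hom[OF group_semidirect \<phi>]) (auto simp: rel)
  have fst_mult: "fst (a \<otimes>\<^bsub>semidirect\<^esub> b) = fst a \<otimes>\<^bsub>presentation S R\<^esub> fst b" for a b
    by (cases a; cases b) simp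
  have Fc: "F g \<in> carrier (presentation S R) \<times> chains" if "g \<in> carrier (presentation S R)" for g
    using hom_in_carrier[OF F(1) that] by simp
  interpret id: group_hom "presentation S R" "presentation S R" id
    by unfold_locales (auto simp: hom_def)
  \<comment> \<open>The first component is an endomorphism fixing all generators, hence the
    identity; only then is the second component a derivation.\<close>
  have "fst \<circ> F \<in> hom (presentation S R) (presentation S R)"
    using Fc by (auto simp: hom_def fst_mult hom_mult[OF F(1)] mem_Times_iff)
  then have fstF: "fst (F g) = g" if "g \<in> carrier (presentation S R)" for g
    using id.hom_eq_on_generate[of "fst \<circ> F" "gen S R ` S" g] F(2) gen_closed that
    unfolding generate_gen by fastforce
  have "snd (F (g \<otimes>\<^bsub>presentation S R\<^esub> h)) = (\<lambda>x. snd (F g) x + shift g (snd (F h)) x)"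
    if "g \<in> carrier (presentation S R)" "h \<in> carrier (presentation S R)" for g h
    using hom_mult[OF F(1) that] fstF[OF that(1)] by (cases "F g"; cases "F h") auto
  then have "derivation (snd \<circ> F)"
    using Fc by (auto simp: derivation_def mem_Times_iff)
  then show thesis using that F(2) by simp
qed

lemma (in group) word_val_commutator:
  assumes "\<phi> u \<in> carrier G" "\<phi> v \<in> carrier G" "\<phi> u \<otimes> \<phi> v = \<phi> v \<otimes> \<phi> u"
  shows "word_val \<phi> [(u, True), (v, True), (u, False), (v, False)] = \<one>"
proof -
  have "\<phi> u \<otimes> (\<phi> v \<otimes> (inv (\<phi> u) \<otimes> inv (\<phi> v))) = (\<phi> u \<otimes> \<phi> v) \<otimes> inv (\<phi> v \<otimes> \<phi> u)"
    using assms(1,2) by (simp add: m_assoc inv_mult_group)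
  then show ?thesis using assms by simp
qed

lemma (in group) commutator_word_val_one:
  assumes "\<phi> u \<in> carrier G" "\<phi> v \<in> carrier G"
    and "word_val \<phi> [(u, True), (v, True), (u, False), (v, False)] = \<one>"
  shows "\<phi> u \<otimes> \<phi> v = \<phi> v \<otimes> \<phi> u"
proof -
  have "(\<phi> u \<otimes> \<phi> v) \<otimes> inv (\<phi> v \<otimes> \<phi> u) = \<one>"
    using assms by (simp add: m_assoc inv_mult_group)
  then show ?thesis using assms(1,2) inv_equality inv_inv by (metis inv_closed m_closed)
qed

subsection \<open>The flat braid group and its edge derivations\<close>

interpretation FB7: presented "{1..6::nat}" FB7_relators
  rewrites "presentation {1..6} FB7_relators = FB7"
  by unfold_locales (auto simp: FB7_relators_def FB7_def)

definition \<sigma> :: "nat \<Rightarrow> nat word set" where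
  "\<sigma> = gen {1..6} FB7_relators"

abbreviation FB7_mult (infixl "\<star>" 70) where
  "x \<star> y \<equiv> x \<otimes>\<^bsub>FB7\<^esub> y"

abbreviation FB7_inv where
  "FB7_inv x \<equiv> inv\<^bsub>FB7\<^esub> x"

lemma word_val_FB7_relators:
  assumes "group G" and \<phi>: "\<phi> \<in> {1..6} \<rightarrow> carrier G"
    and sq: "\<And>i. i \<in> {1..6} \<Longrightarrow> \<phi> i \<otimes>\<^bsub>G\<^esub> \<phi> i = \<one>\<^bsub>G\<^esub>"
    and comm: "\<And>i j. i \<in> {1..6} \<Longrightarrow> j \<in> {1..6} \<Longrightarrow> i + 2 \<le> j \<Longrightarrow> \<phi> i \<otimes>\<^bsub>G\<^esub> \<phi> j = \<phi> j \<otimes>\<^bsub>G\<^esub> \<phi> i"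
    and r: "r \<in> FB7_relators"
  shows "monoid.word_val G \<phi> r = \<one>\<^bsub>G\<^esub>"
proof -
  interpret group G by fact
  from r consider i where "i \<in> {1..6}" "r = [(i, True), (i, True)]"
    | i j where "i \<in> {1..6}" "j \<in> {1..6}" "i \<ge> j + 2 \<or> j \<ge> i + 2"
        "r = [(i, True), (j, True), (i, False), (j, False)]"
    unfolding FB7_relators_def by blast
  then show ?thesis
  proof cases
    case 1
    then have "\<phi> i \<in> carrier G" using \<phi> by blast
    with 1 sq[of i] show ?thesis by simp
  next
    case 2
    then have "\<phi> i \<in> carrier G" "\<phi> j \<in> carrier G" using \<phi> by auto
    moreover have "\<phi> i \<otimes>\<^bsub>G\<^esub> \<phi> j = \<phi> j \<otimes>\<^bsub>G\<^esub> \<phi> i" using 2 comm by metis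
    ultimately show ?thesis unfolding 2(4) by (rule word_val_commutator)
  qed
qed

lemma sigma_closed [simp]: "i \<in> {1..6} \<Longrightarrow> \<sigma> i \<in> carrier FB7"
  unfolding \<sigma>_def by (rule FB7.gen_closed)

lemma FB7_relator_trivial: "r \<in> FB7_relators \<Longrightarrow> FB7.P.word_val \<sigma> r = \<one>\<^bsub>FB7\<^esub>"
  unfolding \<sigma>_def by (rule FB7.relator_trivial)

lemma sigma_sq:
  assumes "i \<in> {1..6}"
  shows "\<sigma> i \<star> \<sigma> i = \<one>\<^bsub>FB7\<^esub>"
proof -
  have "[(i, True), (i, True)] \<in> FB7_relators"
    using assms by (auto simp: FB7_relators_def)
  from FB7_relator_trivial[OF this] show ?thesis using assms by simp
qed

lemma inv_sigma: "i \<in> {1..6} \<Longrightarrow> FB7_inv (\<sigma> i) = \<sigma> i"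
  using sigma_sq by (intro FB7.P.inv_equality) auto

lemma sigma_comm:
  assumes "i \<in> {1..6}" "j \<in> {1..6}" "i + 2 \<le> j \<or> j + 2 \<le> i"
  shows "\<sigma> i \<star> \<sigma> j = \<sigma> j \<star> \<sigma> i"
proof -
  have "[(i, True), (j, True), (i, False), (j, False)] \<in> FB7_relators"
    using assms by (auto simp: FB7_relators_def)
  then show ?thesis
    using assms by (intro FB7.P.commutator_word_val_one sigma_closed FB7_relator_trivial)
qed

lemma FB7_hom:
  assumes "group G" and "\<phi> \<in> {1..6} \<rightarrow> carrier G"
    and "\<And>i. i \<in> {1..6} \<Longrightarrow> \<phi> i \<otimes>\<^bsub>G\<^esub> \<phi> i = \<one>\<^bsub>G\<^esub>"
    and "\<And>i j. i \<in> {1..6} \<Longrightarrow> j \<in> {1..6} \<Longrightarrow> i + 2 \<le> j \<Longrightarrow> \<phi> i \<otimes>\<^bsub>G\<^esub> \<phi> j = \<phi> j \<otimes>\<^bsub>G\<^esub> \<phi> i"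
  obtains F where "F \<in> hom FB7 G" "\<And>i. i \<in> {1..6} \<Longrightarrow> F (\<sigma> i) = \<phi> i"
    "\<And>w. w \<in> carrier (free_group {1..6}) \<Longrightarrow> F (FB7.cls w) = monoid.word_val G \<phi> w"
  unfolding \<sigma>_def
  using FB7.presentation_hom[OF assms(1,2) word_val_FB7_relators[OF assms]] by blast

section \<open>Words in the generators and parabolic subgroups\<close>

definition sprod :: "nat list \<Rightarrow> nat word set" where
  "sprod is = foldr (\<lambda>i g. \<sigma> i \<star> g) is \<one>\<^bsub>FB7\<^esub>"

lemma sprod_simps [simp]: "sprod [] = \<one>\<^bsub>FB7\<^esub>" "sprod (i # is) = \<sigma> i \<star> sprod is"
  by (simp_all add: sprod_def)

lemma sprod_closed [simp]: "set is \<subseteq> {1..6} \<Longrightarrow> sprod is \<in> carrier FB7"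
  by (induction "is") auto

lemma sprod_append:
  "set is \<subseteq> {1..6} \<Longrightarrow> set js \<subseteq> {1..6} \<Longrightarrow> sprod (is @ js) = sprod is \<star> sprod js"
  by (induction "is") (auto simp: FB7.P.m_assoc)

lemma sprod_snoc: "set is \<subseteq> {1..6} \<Longrightarrow> i \<in> {1..6} \<Longrightarrow> sprod (is @ [i]) = sprod is \<star> \<sigma> i"
  by (subst sprod_append) auto

definition parabolic :: "nat set \<Rightarrow> nat word set set" where
  "parabolic A = generate FB7 (\<sigma> ` A)"

lemma subgroup_parabolic: "A \<subseteq> {1..6} \<Longrightarrow> subgroup (parabolic A) FB7"
  unfolding parabolic_def by (rule FB7.P.generate_is_subgroup) auto

text \<open>The generators are involutions, so words without signs already exhaust the
  subgroup.\<close>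

lemma parabolic_sprod:
  assumes "A \<subseteq> {1..6}"
  shows "g \<in> parabolic A \<longleftrightarrow> (\<exists>is. set is \<subseteq> A \<and> g = sprod is)"
proof
  assume "g \<in> parabolic A"
  then show "\<exists>is. set is \<subseteq> A \<and> g = sprod is"
    unfolding parabolic_def
  proof (induction g rule: generate.induct)
    case one
    then show ?case by (intro exI[of _ "[]"]) simp
  next
    case (incl h)
    then obtain i where "i \<in> A" "h = \<sigma> i" by auto
    then show ?case using assms by (intro exI[of _ "[i]"]) auto
  next
    case (inv h)
    then obtain i where "i \<in> A" "h = \<sigma> i" by auto
    then show ?case using assms by (intro exI[of _ "[i]"]) (auto simp: inv_sigma)
  next
    case (eng g h)
    then obtain "is" js where "set is \<subseteq> A" "g = sprod is" "set js \<subseteq> A" "h = sprod js" by auto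
    then show ?case using assms by (intro exI[of _ "is @ js"]) (auto simp: sprod_append)
  qed
next
  assume "\<exists>is. set is \<subseteq> A \<and> g = sprod is"
  then obtain "is" where "set is \<subseteq> A" "g = sprod is" by auto
  then show "g \<in> parabolic A"
    unfolding parabolic_def
    by (induction "is" arbitrary: g) (auto intro: generate.one generate.incl intro!: generate.eng)
qed

lemma parabolic_top: "parabolic {1..6} = carrier FB7"
  unfolding parabolic_def \<sigma>_def by (rule FB7.generate_gen)

lemma parabolic_closed: "A \<subseteq> {1..6} \<Longrightarrow> g \<in> parabolic A \<Longrightarrow> g \<in> carrier FB7"
  using subgroup.subset[OF subgroup_parabolic] by blast

lemma parabolic_mono: "A \<subseteq> B \<Longrightarrow> parabolic A \<subseteq> parabolic B"
  unfolding parabolic_def by (intro FB7.P.mono_generate image_mono)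

text \<open>Killing the generators outside \<open>A\<close> preserves the relations, which are only
  squares and commutations.\<close>

lemma retraction_hom:
  obtains \<rho> where "\<rho> \<in> hom FB7 FB7" "\<And>i. i \<in> {1..6} \<Longrightarrow> \<rho> (\<sigma> i) = (if i \<in> A then \<sigma> i else \<one>\<^bsub>FB7\<^esub>)"
  by (rule FB7_hom[OF FB7.P.is_group, of "\<lambda>i. if i \<in> A then \<sigma> i else \<one>\<^bsub>FB7\<^esub>"])
     (simp_all add: sigma_sq sigma_comm del: One_nat_def)

section \<open>Edges of the Bass-Serre trees\<close>

definition link :: "nat \<Rightarrow> nat set" where
  "link t = {i \<in> {1..6}. i + 2 \<le> t \<or> t + 2 \<le> i}"

lemma link_subset: "link t \<subseteq> {1..6}" and link_neq: "i \<in> link t \<Longrightarrow> i \<noteq> t"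
  by (auto simp: link_def)

text \<open>\<open>FB7\<close> is the amalgam of \<open>parabolic ({1..6} - {t})\<close> and
  \<open>parabolic (link t \<union> {t})\<close> over \<open>parabolic (link t)\<close>. The second
  factor contains the edge group with index two, so its vertices have valence two and join
  \<open>edge t g\<close> to \<open>edge t (g \<star> \<sigma> t)\<close>.\<close>

abbreviation edges :: "nat \<Rightarrow> nat word set set set" where
  "edges t \<equiv> (\<lambda>g. g <#\<^bsub>FB7\<^esub> parabolic (link t)) ` carrier FB7"

interpretation edges: gset FB7 "edges t" "\<lambda>g x. g <#\<^bsub>FB7\<^esub> x" for t
  by (intro FB7.P.gset_lcosets subgroup_parabolic link_subset)

abbreviation edge :: "nat \<Rightarrow> nat word set \<Rightarrow> nat word set set" where
  "edge t g \<equiv> g <#\<^bsub>FB7\<^esub> parabolic (link t)"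

lemma act_edge:
  "g \<in> carrier FB7 \<Longrightarrow> h \<in> carrier FB7 \<Longrightarrow> g <#\<^bsub>FB7\<^esub> edge t h = edge t (g \<star> h)"
  using subgroup.subset[OF subgroup_parabolic[OF link_subset]] by (intro FB7.P.lcos_m_assoc) auto

lemma edge_eq_iff:
  "g \<in> carrier FB7 \<Longrightarrow> h \<in> carrier FB7 \<Longrightarrow> edge t g = edge t h \<longleftrightarrow> FB7_inv h \<star> g \<in> parabolic (link t)"
  by (intro FB7.P.lcos_eq_iff subgroup_parabolic link_subset)

lemma edge_sigma_link:
  assumes "g \<in> carrier FB7" "i \<in> link t"
  shows "edge t (g \<star> \<sigma> i) = edge t g"
proof -
  have i: "\<sigma> i \<in> carrier FB7" using assms(2) by (simp add: link_def)
  have "FB7_inv g \<star> (g \<star> \<sigma> i) = \<sigma> i" using assms(1) i by (simp add: FB7.P.m_assoc[symmetric])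
  then show ?thesis
    using assms i by (subst edge_eq_iff) (auto simp: parabolic_def intro: generate.incl)
qed

text \<open>One step of a path through a vertex of valence two: \<open>a\<close> is run through
  against its orientation, \<open>b\<close> along it.\<close>

definition dchain :: "'x \<Rightarrow> 'x \<Rightarrow> 'x \<Rightarrow> int" where
  "dchain a b x = of_bool (x = b) - of_bool (x = a)"

context gset
begin

lemma dchain_chain: "a \<in> Y \<Longrightarrow> b \<in> Y \<Longrightarrow> dchain a b \<in> chains"
  by (auto simp: chains_def dchain_def intro: finite_subset[of _ "{a, b}"])

lemma shift_dchain:
  assumes "g \<in> carrier G" "a \<in> Y" "b \<in> Y"
  shows "shift g (dchain a b) = dchain (act g a) (act g b)"
proof
  fix x
  have "act (inv g) x = a \<longleftrightarrow> x = act g a" if "x \<in> Y" "a \<in> Y" for a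
    using assms(1) that by auto
  then show "shift g (dchain a b) x = dchain (act g a) (act g b) x"
    using assms by (cases "x \<in> Y") (auto simp: shift_def dchain_def)
qed

lemma pair_dchain:
  assumes "a \<in> Y" "b \<in> Y"
  shows "pair \<omega> (dchain a b) = \<omega> b - \<omega> a"
proof -
  have "pair \<omega> (dchain a b) = (\<Sum>x\<in>{a, b}. \<omega> x * dchain a b x)"
    by (rule pair_superset) (auto simp: dchain_def)
  then show ?thesis by (cases "a = b") (simp_all add: dchain_def)
qed

end

text \<open>\<open>\<sigma> t\<close> swaps the two edges of the step and so negates it, which gives
  the square relation. A generator in \<open>link t\<close> fixes both edges, which gives its
  commutation with \<open>\<sigma> t\<close>. All other relators involve only zero values.\<close>

lemma edge_derivation_ex:
  assumes t: "t \<in> {1..6}"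
  shows "\<exists>D. edges.derivation t D \<and> D (\<sigma> t) = dchain (edge t \<one>\<^bsub>FB7\<^esub>) (edge t (\<sigma> t)) \<and>
    (\<forall>i\<in>{1..6} - {t}. D (\<sigma> i) = (\<lambda>_. 0))"
proof -
  define d where "d i = (if i = t then dchain (edge t \<one>\<^bsub>FB7\<^esub>) (edge t (\<sigma> t)) else (\<lambda>_. 0))" for i
  interpret SD: group "edges.semidirect t" by (rule edges.group_semidirect)
  have e: "edge t \<one>\<^bsub>FB7\<^esub> \<in> edges t" "edge t (\<sigma> t) \<in> edges t" using t by auto
  have d: "d \<in> {1..6} \<rightarrow> edges.chains t"
    using edges.dchain_chain[OF e] edges.zero_chain by (simp add: d_def)
  have sq: "edges.shift t (\<sigma> t) (d t) = (\<lambda>x. - d t x)"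
    using t e by (auto simp: d_def edges.shift_dchain act_edge sigma_sq dchain_def)
  have inv: "edges.shift t (\<sigma> i) (d t) = d t" if "i \<in> link t" for i
  proof -
    have i: "i \<in> {1..6}" using that link_subset by blast
    then have "edge t (\<sigma> i) = edge t \<one>\<^bsub>FB7\<^esub>" "edge t (\<sigma> t \<star> \<sigma> i) = edge t (\<sigma> t)"
      using edge_sigma_link[OF FB7.P.one_closed that] edge_sigma_link[OF sigma_closed[OF t] that]
      by simp_all
    moreover have "\<sigma> i \<star> \<sigma> t = \<sigma> t \<star> \<sigma> i" using that t by (intro sigma_comm) (auto simp: link_def)
    ultimately show ?thesis
      using t e i by (simp add: d_def edges.shift_dchain act_edge)
  qed
  have "monoid.word_val (edges.semidirect t) (\<lambda>i. (\<sigma> i, d i)) r = \<one>\<^bsub>edges.semidirect t\<^esub>"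
    if "r \<in> FB7_relators" for r
  proof (rule word_val_FB7_relators[OF SD.is_group _ _ _ that])
    show "(\<lambda>i. (\<sigma> i, d i)) \<in> {1..6} \<rightarrow> carrier (edges.semidirect t)"
      using d by auto
    show "(\<sigma> i, d i) \<otimes>\<^bsub>edges.semidirect t\<^esub> (\<sigma> i, d i) = \<one>\<^bsub>edges.semidirect t\<^esub>" if "i \<in> {1..6}" for i
      using that sq by (cases "i = t") (auto simp: sigma_sq d_def)
    fix i j :: nat assume ij: "i \<in> {1..6}" "j \<in> {1..6}" "i + 2 \<le> j"
    have comm: "\<sigma> i \<star> \<sigma> j = \<sigma> j \<star> \<sigma> i" using ij by (intro sigma_comm) auto
    consider "i = t" "j \<in> link t" | "j = t" "i \<in> link t" | "i \<noteq> t" "j \<noteq> t"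
      using ij by (auto simp: link_def)
    then show "(\<sigma> i, d i) \<otimes>\<^bsub>edges.semidirect t\<^esub> (\<sigma> j, d j) = (\<sigma> j, d j) \<otimes>\<^bsub>edges.semidirect t\<^esub> (\<sigma> i, d i)"
    proof cases
      case 1
      then have "d j = (\<lambda>_. 0)" using link_neq by (auto simp: d_def)
      with 1 inv[of j] comm show ?thesis by simp
    next
      case 2
      then have "d i = (\<lambda>_. 0)" using link_neq by (auto simp: d_def)
      with 2 inv[of i] comm show ?thesis by simp
    qed (simp_all add: d_def comm)
  qed
  then have "monoid.word_val (edges.semidirect t) (\<lambda>i. (gen {1..6} FB7_relators i, d i)) r
      = (\<one>\<^bsub>FB7\<^esub>, \<lambda>_. 0)" if "r \<in> FB7_relators" for r
    using that unfolding \<sigma>_def by (simp only: edges.semidirect_simps(3))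
  then obtain D where "edges.derivation t D" "\<And>i. i \<in> {1..6} \<Longrightarrow> D (\<sigma> i) = d i"
    unfolding \<sigma>_def by (rule FB7.presentation_derivation[OF edges.gset_axioms d]) (assumption | blast)+
  with t show ?thesis by (intro exI[of _ D]) (simp add: d_def)
qed

section \<open>The signed geodesic as a derivation\<close>

definition edge_path :: "nat \<Rightarrow> nat word set \<Rightarrow> nat word set set \<Rightarrow> int" where
  "edge_path t = (SOME D. edges.derivation t D \<and> D (\<sigma> t) = dchain (edge t \<one>\<^bsub>FB7\<^esub>) (edge t (\<sigma> t)) \<and>
    (\<forall>i\<in>{1..6} - {t}. D (\<sigma> i) = (\<lambda>_. 0)))"

lemma edge_path:
  assumes "t \<in> {1..6}"
  shows "edges.derivation t (edge_path t)"
    and "edge_path t (\<sigma> t) = dchain (edge t \<one>\<^bsub>FB7\<^esub>) (edge t (\<sigma> t))"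
    and "i \<in> {1..6} \<Longrightarrow> i \<noteq> t \<Longrightarrow> edge_path t (\<sigma> i) = (\<lambda>_. 0)"
  using someI_ex[OF edge_derivation_ex[OF assms]] unfolding edge_path_def[symmetric] by auto

text \<open>Reading a word from left to right traces the path from the vertex fixed by
  \<open>parabolic ({1..6} - {t})\<close>: a letter \<open>t\<close> advances it by one step, any
  other letter only turns about its current end vertex.\<close>

lemma edge_path_mult_sigma:
  assumes t: "t \<in> {1..6}" and g: "g \<in> carrier FB7"
  shows "edge_path t (g \<star> \<sigma> t) = (\<lambda>x. edge_path t g x + dchain (edge t g) (edge t (g \<star> \<sigma> t)) x)"
    and "i \<in> {1..6} \<Longrightarrow> i \<noteq> t \<Longrightarrow> edge_path t (g \<star> \<sigma> i) = edge_path t g"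
  using t g edges.derivation_mult[OF edge_path(1)[OF t]]
  by (simp_all add: edge_path edges.shift_dchain act_edge)

lemma edge_path_parabolic:
  assumes t: "t \<in> {1..6}" and g: "g \<in> parabolic ({1..6} - {t})"
  shows "edge_path t g = (\<lambda>_. 0)"
proof -
  have "edge_path t (sprod is) = (\<lambda>_. 0)" if "set is \<subseteq> {1..6} - {t}" for "is"
    using that
  proof (induction "is" rule: rev_induct)
    case Nil
    show ?case using edges.derivation_one[OF edge_path(1)[OF t]] by simp
  next
    case (snoc i "is")
    then have "set is \<subseteq> {1..6}" "i \<in> {1..6}" "i \<noteq> t" by auto
    with snoc t show ?case by (simp add: sprod_snoc edge_path_mult_sigma(2))
  qed
  then show ?thesis using g by (auto simp: parabolic_sprod)
qed

text \<open>The first step leaves \<open>edge t (sprod as)\<close> and makes its coefficient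
  negative. A later step can raise that coefficient only by arriving at the same edge, which is the
  backtracking recorded in the second alternative.\<close>

lemma edge_path_first_edge:
  assumes t: "t \<in> {1..6}" and as: "set as \<subseteq> {1..6} - {t}" and bs: "set bs \<subseteq> {1..6}"
  shows "edge_path t (sprod (as @ t # bs)) (edge t (sprod as)) < 0 \<or>
    (\<exists>ds es. t # bs = ds @ t # es \<and> edge t (sprod (as @ ds @ [t])) = edge t (sprod as))"
  using bs
proof (induction bs rule: rev_induct)
  case Nil
  have as': "set as \<subseteq> {1..6}" using as by auto
  have "edge_path t (sprod as) = (\<lambda>_. 0)"
    using as t by (intro edge_path_parabolic) (auto simp: parabolic_sprod)
  then have "edge_path t (sprod (as @ [t])) (edge t (sprod as))
      = dchain (edge t (sprod as)) (edge t (sprod (as @ [t]))) (edge t (sprod as))"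
    using as' t by (simp add: sprod_snoc edge_path_mult_sigma)
  \<comment> \<open>If the first step did not change the edge, the second alternative holds with
    \<open>ds = []\<close>; so \<open>\<sigma> t\<close> need not be shown to lie outside the edge
    group.\<close>
  then show ?case by (fastforce simp: dchain_def intro: exI[of _ "[]"])
next
  case (snoc i bs)
  then have IH: "edge_path t (sprod (as @ t # bs)) (edge t (sprod as)) < 0 \<or>
    (\<exists>ds es. t # bs = ds @ t # es \<and> edge t (sprod (as @ ds @ [t])) = edge t (sprod as))"
    and i: "i \<in> {1..6}" and c: "set (as @ t # bs) \<subseteq> {1..6}" using as t by auto
  have eq: "sprod (as @ t # bs @ [i]) = sprod (as @ t # bs) \<star> \<sigma> i"
    using sprod_snoc[OF c i] by simp
  from IH show ?case
  proof
    assume "\<exists>ds es. t # bs = ds @ t # es \<and> edge t (sprod (as @ ds @ [t])) = edge t (sprod as)"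
    then obtain ds es where "t # bs = ds @ t # es" "edge t (sprod (as @ ds @ [t])) = edge t (sprod as)"
      by blast
    then have "t # bs @ [i] = ds @ t # es @ [i]" "edge t (sprod (as @ ds @ [t])) = edge t (sprod as)"
      by (metis append_Cons append_assoc)+
    then show ?thesis by blast
  next
    assume neg: "edge_path t (sprod (as @ t # bs)) (edge t (sprod as)) < 0"
    show ?thesis
    proof (cases "i = t \<and> edge t (sprod (as @ t # bs @ [t])) = edge t (sprod as)")
      case True
      then have "t # bs @ [i] = (t # bs) @ t # [] \<and> edge t (sprod (as @ (t # bs) @ [t])) = edge t (sprod as)"
        by simp
      then show ?thesis by blast
    next
      case False
      \<comment> \<open>A step that does not end at the first edge contributes 0 or -1
        there.\<close>
      then have "edge_path t (sprod (as @ t # bs @ [i])) (edge t (sprod as)) < 0"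
        using neg t i sprod_closed[OF c] eq
        by (cases "i = t") (auto simp: edge_path_mult_sigma dchain_def)
      then show ?thesis by blast
    qed
  qed
qed

text \<open>A word with as few letters \<open>t\<close> as possible traces a path without backtracking in the
  Bass--Serre tree, so its first edge cannot cancel in \<open>edge_path t\<close>.\<close>

lemma edge_path_zero_imp_parabolic:
  assumes t: "t \<in> {1..6}" and g: "g \<in> carrier FB7" "edge_path t g = (\<lambda>_. 0)"
  shows "g \<in> parabolic ({1..6} - {t})"
proof -
  have "\<exists>is. set is \<subseteq> {1..6} \<and> g = sprod is"
    using g(1) parabolic_sprod[of "{1..6}" g] parabolic_top by simp
  then obtain "is" where "is": "set is \<subseteq> {1..6}" "g = sprod is"
    and min: "\<And>js. set js \<subseteq> {1..6} \<Longrightarrow> g = sprod js \<Longrightarrow> count_list is t \<le> count_list js t"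
    using ex_has_least_nat[of "\<lambda>is. set is \<subseteq> {1..6} \<and> g = sprod is" _ "\<lambda>is. count_list is t"] by metis
  have "t \<notin> set is"
  proof
    assume "t \<in> set is"
    then obtain as bs where ab: "is = as @ t # bs" "t \<notin> set as" using split_list_first by metis
    have as: "set as \<subseteq> {1..6} - {t}" and bs: "set bs \<subseteq> {1..6}" using ab "is"(1) by auto
    from edge_path_first_edge[OF t as bs] obtain ds es where
      de: "t # bs = ds @ t # es" "edge t (sprod (as @ ds @ [t])) = edge t (sprod as)"
      using g(2) "is"(2) ab(1) by auto
    have "set ds \<subseteq> set (t # bs)" "set es \<subseteq> set (t # bs)" unfolding de(1) by auto
    then have sub: "set as \<subseteq> {1..6}" "set ds \<subseteq> {1..6}" "set es \<subseteq> {1..6}"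
      using as bs t by auto
    \<comment> \<open>The detour \<open>ds @ [t]\<close> returns to the same edge, so after
      \<open>as\<close> it represents an element of the edge group. Replacing it by a word
      \<open>ks\<close> in \<open>link t\<close> removes at least one letter \<open>t\<close>,
      against minimality.\<close>
    let ?k = "FB7_inv (sprod as) \<star> sprod (as @ ds @ [t])"
    have "?k \<in> parabolic (link t)"
      using edge_eq_iff[of "sprod (as @ ds @ [t])" "sprod as" t] de(2) sub t by simp
    then obtain ks where ks: "set ks \<subseteq> link t" "?k = sprod ks"
      using parabolic_sprod[OF link_subset] by auto
    have ks': "set ks \<subseteq> {1..6}" "t \<notin> set ks" using ks(1) by (auto simp: link_def)
    have "sprod as \<star> sprod ks = sprod (as @ ds @ [t])"
      unfolding ks(2)[symmetric] using sub t by (simp add: FB7.P.m_assoc[symmetric])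
    then have "sprod ((as @ ds @ [t]) @ es) = sprod ((as @ ks) @ es)"
      using sub t ks' by (subst (1 2) sprod_append) (auto simp: sprod_append)
    then have "g = sprod (as @ ks @ es)" using "is"(2) ab(1) de(1) by simp
    then have "count_list is t \<le> count_list (as @ ks @ es) t"
      using sub ks' by (intro min) auto
    moreover have "count_list is t = count_list as t + count_list ds t + Suc (count_list es t)"
      unfolding ab(1) de(1) by simp
    moreover have "count_list ks t = 0" using ks'(2) by simp
    ultimately show False by simp
  qed
  then show ?thesis using "is" by (auto simp: parabolic_sprod)
qed

subsection \<open>A homomorphism on the pure flat braid group\<close>

abbreviation perm :: "nat word set \<Rightarrow> nat \<Rightarrow> nat" where
  "perm \<equiv> FB7_to_Sym7"

lemma transpose_permutes: "i \<in> {1..6} \<Longrightarrow> transpose i (i + 1) \<in> carrier (sym_group 7)"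
  by (simp add: sym_group_carrier permutes_swap_id)

lemma word_perm_word_val:
  assumes "fst ` set w \<subseteq> {1..6}"
  shows "word_perm w = monoid.word_val (sym_group 7) (\<lambda>i. transpose i (i + 1)) w"
proof -
  interpret S: group "sym_group 7" by (rule sym_group_is_group)
  have inv: "inv\<^bsub>sym_group 7\<^esub> (transpose i (i + 1)) = transpose i (i + 1)" if "i \<in> {1..6}" for i
    using transpose_permutes[OF that]
    by (intro S.inv_equality) (auto simp: sym_group_mult sym_group_one)
  show ?thesis
    using assms
  proof (induction w)
    case Nil
    then show ?case by (simp add: word_perm_def sym_group_one)
  next
    case (Cons a w)
    obtain i b where a: "a = (i, b)" by force
    with Cons have "word_perm w = S.word_val (\<lambda>i. transpose i (i + 1)) w" "i \<in> {1..6}" by auto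
    then show ?case
      using inv[of i] by (simp add: a word_perm_def sym_group_mult)
  qed
qed

text \<open>\<open>FB7_to_Sym7\<close> evaluates an arbitrarily chosen word of the coset; it agrees
  with the homomorphism from von Dyck's theorem because that one is computed by every
  representative.\<close>

lemma perm_hom: "perm \<in> hom FB7 (sym_group 7)"
  and perm_sigma: "i \<in> {1..6} \<Longrightarrow> perm (\<sigma> i) = transpose i (i + 1)"
proof -
  obtain F where F: "F \<in> hom FB7 (sym_group 7)" "\<And>i. i \<in> {1..6} \<Longrightarrow> F (\<sigma> i) = transpose i (i + 1)"
    "\<And>w. w \<in> carrier (free_group {1..6}) \<Longrightarrow>
       F (FB7.cls w) = monoid.word_val (sym_group 7) (\<lambda>i. transpose i (i + 1)) w"
  proof (rule FB7_hom[OF sym_group_is_group])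
    show "(\<lambda>i. transpose i (i + 1)) \<in> {1..6} \<rightarrow> carrier (sym_group 7)"
      using transpose_permutes by blast
  next
    fix i j :: nat assume "i + 2 \<le> j"
    then show "transpose i (i + 1) \<otimes>\<^bsub>sym_group 7\<^esub> transpose j (j + 1)
        = transpose j (j + 1) \<otimes>\<^bsub>sym_group 7\<^esub> transpose i (i + 1)"
      by (auto simp: sym_group_mult fun_eq_iff transpose_def)
  qed (auto simp: sym_group_mult sym_group_one)
  have eq: "perm c = F c" if "c \<in> carrier FB7" for c
  proof -
    obtain w where w: "w \<in> carrier (free_group {1..6})" "c = FB7.cls w"
      using FB7.presentation_cases \<open>c \<in> carrier FB7\<close> by blast
    define v where "v = (SOME v. v \<in> c)"
    have "w \<in> c" unfolding w(2) by (rule free.rcos_self[OF w(1) FB7.subgroup_axioms])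
    then have "v \<in> c" unfolding v_def by (rule someI)
    then have v: "v \<in> carrier (free_group {1..6})" "c = FB7.cls v"
      using free.r_coset_subset_G[OF FB7.subset w(1)] free.repr_independence[OF _ w(1) FB7.subgroup_axioms] w(2)
      by blast+
    have "perm c = word_perm v" by (simp add: FB7_to_Sym7_def v_def)
    also have "\<dots> = F c" unfolding v(2) F(3)[OF v(1)] using v(1) by (intro word_perm_word_val) simp
    finally show ?thesis .
  qed
  show "perm \<in> hom FB7 (sym_group 7)" using F(1) eq by (auto simp: hom_def)
  show "perm (\<sigma> i) = transpose i (i + 1)" if "i \<in> {1..6}" using that eq F(2) by simp
qed

lemma group_hom_perm: "group_hom FB7 (sym_group 7) perm"
  using perm_hom sym_group_is_group by (intro group_hom.intro group_hom_axioms.intro FB7.P.is_group)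

lemma perm_mult: "g \<in> carrier FB7 \<Longrightarrow> h \<in> carrier FB7 \<Longrightarrow> perm (g \<star> h) = perm g \<circ> perm h"
  using hom_mult[OF perm_hom] by (simp add: sym_group_mult)

lemma perm_one: "perm \<one>\<^bsub>FB7\<^esub> = id"
  using group_hom.hom_one[OF group_hom_perm] by (simp add: sym_group_one)

lemma PFB7_simps [simp]:
  "g \<in> carrier PFB7 \<longleftrightarrow> g \<in> carrier FB7 \<and> perm g = id"
  "monoid.mult PFB7 = monoid.mult FB7" "one PFB7 = one FB7"
  by (auto simp: PFB7_def kernel_def sym_group_one)

lemma subgroup_PFB7: "subgroup (carrier PFB7) FB7"
  using group_hom.subgroup_kernel[OF group_hom_perm] by (simp add: PFB7_def)

lemma PFB7_eq: "PFB7 = FB7\<lparr>carrier := carrier PFB7\<rparr>"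
  by (simp add: PFB7_def)

lemma perm_conj:
  assumes "g \<in> carrier FB7" "h \<in> carrier FB7" "perm g = id"
  shows "perm (FB7_inv h \<star> g \<star> h) = id"
proof -
  have "perm (FB7_inv h \<star> g \<star> h) = perm (FB7_inv h) \<circ> perm h"
    using assms by (simp add: perm_mult)
  also have "\<dots> = perm (FB7_inv h \<star> h)"
    using assms(2) by (intro perm_mult[symmetric]) auto
  finally show ?thesis using assms by (simp add: perm_one)
qed

text \<open>The quotient by \<open>PFB7\<close> of the Bass--Serre tree of the splitting of \<open>FB7\<close> over
  \<open>parabolic {1, 2, 5, 6}\<close> is the inclusion graph of 3- and 4-element subsets of \<open>{1..7}\<close>;
  \<open>weight\<close> is the indicator of its edge from \<open>{1, 2, 3}\<close> to \<open>{1, 2, 3, 4}\<close>.\<close>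

definition weight :: "(nat \<Rightarrow> nat) \<Rightarrow> int" where
  "weight p = of_bool (p 4 = 4 \<and> p ` {1, 2, 3} = {1, 2, 3})"

lemma weight_sigma:
  assumes g: "g \<in> carrier FB7" and i: "i \<in> {1, 2, 5, 6}"
  shows "weight (perm (g \<star> \<sigma> i)) = weight (perm g)"
proof -
  have "i \<in> {1..6}" using i by auto
  then have eq: "perm (g \<star> \<sigma> i) = perm g \<circ> transpose i (i + 1)"
    using g by (simp add: perm_mult perm_sigma)
  have "transpose i (i + 1) ` {1, 2, 3} = {1, 2, 3}" "transpose i (i + 1) 4 = 4"
    using i by (auto simp: transpose_def)
  then show ?thesis unfolding weight_def eq image_comp[symmetric] by simp
qed

lemma weight_parabolic:
  assumes g: "g \<in> carrier FB7" and h: "h \<in> parabolic {1, 2, 5, 6}"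
  shows "weight (perm (g \<star> h)) = weight (perm g)"
proof -
  have "weight (perm (g \<star> sprod is)) = weight (perm g)" if "set is \<subseteq> {1, 2, 5, 6}" for "is"
    using that
  proof (induction "is" rule: rev_induct)
    case (snoc i "is")
    then have "set is \<subseteq> {1..6}" "i \<in> {1..6}" "i \<in> {1, 2, 5, 6}" "set is \<subseteq> {1, 2, 5, 6}" by auto
    with snoc.IH g show ?case
      by (simp add: sprod_snoc FB7.P.m_assoc[symmetric] weight_sigma)
  qed (use g in simp)
  moreover have "{1, 2, 5, 6} \<subseteq> {1..6::nat}" by auto
  ultimately show ?thesis using h by (auto simp: parabolic_sprod)
qed

section \<open>Signed crossing counts\<close>

definition edge_weight :: "nat word set set \<Rightarrow> int" where
  "edge_weight x = weight (perm (SOME g. g \<in> carrier FB7 \<and> x = edge 3 g))"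

lemma link_3: "link 3 = {1, 5, 6}" and link_4: "link 4 = {1, 2, 6}"
  by (auto simp: link_def)

text \<open>The chosen representative does not matter: \<open>link 3\<close> lies in
  \<open>{1, 2, 5, 6}\<close>, whose generators preserve both 4 and the set
  \<open>{1, 2, 3}\<close>.\<close>

lemma edge_weight:
  assumes g: "g \<in> carrier FB7"
  shows "edge_weight (edge 3 g) = weight (perm g)"
proof -
  define h where "h = (SOME h. h \<in> carrier FB7 \<and> edge 3 g = edge 3 h)"
  have h: "h \<in> carrier FB7 \<and> edge 3 g = edge 3 h"
    unfolding h_def by (rule someI[of _ g]) (use g in simp)
  then have "FB7_inv g \<star> h \<in> parabolic {1, 5, 6}"
    using edge_eq_iff[of h g 3] g by (simp add: link_3)
  then have "FB7_inv g \<star> h \<in> parabolic {1, 2, 5, 6}"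
    using parabolic_mono[of "{1, 5, 6}" "{1, 2, 5, 6}"] by auto
  from weight_parabolic[OF g this] have "weight (perm h) = weight (perm g)"
    using g h by (simp add: FB7.P.m_assoc[symmetric])
  then show ?thesis by (simp add: edge_weight_def h_def)
qed

text \<open>The weighted count along the path of \<open>g\<close> moved to start at the
  \<open>h\<close>-translate of the base vertex. With \<open>h\<close> the identity it restricts to
  a homomorphism from \<open>PFB7\<close> to the integers; general \<open>h\<close> is there for
  changes of base point.\<close>

definition flow :: "nat word set \<Rightarrow> nat word set \<Rightarrow> int" where
  "flow h g = edges.pair (\<lambda>x. edge_weight (h <#\<^bsub>FB7\<^esub> x)) (edge_path 3 g)"

lemma flow_one: "flow h \<one>\<^bsub>FB7\<^esub> = 0"
  using edges.derivation_one[OF edge_path(1), of 3]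
  by (simp add: flow_def edges.pair_def)

text \<open>In the tree of the splitting over \<open>parabolic {1, 2, 5, 6}\<close>, a letter 3 goes
  in along one edge and out along another through a translate of the vertex of
  \<open>parabolic ({1..6} - {4})\<close>. The letter 4 turns about the other kind of vertex, where
  the path pauses, and adds nothing.\<close>

lemma flow_mult_sigma:
  assumes "h \<in> carrier FB7" "g \<in> carrier FB7"
  shows "flow h (g \<star> \<sigma> 3) = flow h g + weight (perm (h \<star> g \<star> \<sigma> 3)) - weight (perm (h \<star> g))"
    and "i \<in> {1..6} \<Longrightarrow> i \<noteq> 3 \<Longrightarrow> flow h (g \<star> \<sigma> i) = flow h g"
proof -
  have e: "edge 3 g \<in> edges 3" "edge 3 (g \<star> \<sigma> 3) \<in> edges 3" using assms by auto
  have "edge_path 3 g \<in> edges.chains 3"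
    using assms by (intro edges.derivation_chain edge_path(1)) auto
  then show "flow h (g \<star> \<sigma> 3) = flow h g + weight (perm (h \<star> g \<star> \<sigma> 3)) - weight (perm (h \<star> g))"
    using assms edges.dchain_chain[OF e] edges.pair_dchain[OF e]
    by (simp add: flow_def edge_path_mult_sigma(1) edges.pair_add act_edge edge_weight FB7.P.m_assoc)
  show "flow h (g \<star> \<sigma> i) = flow h g" if "i \<in> {1..6}" "i \<noteq> 3"
    using assms that by (simp add: flow_def edge_path_mult_sigma(2))
qed

lemma flow_one_eq: "g \<in> carrier FB7 \<Longrightarrow> flow \<one>\<^bsub>FB7\<^esub> g = edges.pair edge_weight (edge_path 3 g)"
  unfolding flow_def
  by (intro edges.pair_cong[where t = 3] edges.derivation_chain edge_path(1)) (auto simp: act_edge)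

lemma edge_weight_invariant:
  assumes "g \<in> carrier PFB7" "m \<in> edges.chains 3"
  shows "edges.pair edge_weight (edges.shift 3 g m) = edges.pair edge_weight m"
proof -
  have "edges.pair edge_weight (edges.shift 3 g m) = edges.pair (\<lambda>x. edge_weight (g <#\<^bsub>FB7\<^esub> x)) m"
    using assms by (intro edges.pair_shift) auto
  also have "\<dots> = edges.pair edge_weight m"
    using assms by (intro edges.pair_cong[where t = 3]) (auto simp: act_edge edge_weight perm_mult)
  finally show ?thesis .
qed

lemma edge_path_chain: "g \<in> carrier FB7 \<Longrightarrow> edge_path 3 g \<in> edges.chains 3"
  by (intro edges.derivation_chain edge_path(1)) auto

lemma edge_path_mult:
  assumes "t \<in> {1..6}" "g \<in> carrier FB7" "h \<in> carrier FB7"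
  shows "edge_path t (g \<star> h) = (\<lambda>x. edge_path t g x + edges.shift t g (edge_path t h) x)"
  using assms by (intro edges.derivation_mult edge_path(1))

lemma flow_mult:
  assumes "g \<in> carrier PFB7" "h \<in> carrier FB7"
  shows "flow \<one>\<^bsub>FB7\<^esub> (g \<star> h) = flow \<one>\<^bsub>FB7\<^esub> g + flow \<one>\<^bsub>FB7\<^esub> h"
  using assms
  by (simp add: flow_one_eq edge_path_mult edges.pair_add[where t = 3] edge_path_chain
      edges.shift_chain edge_weight_invariant)

lemma flow_pow:
  assumes "g \<in> carrier PFB7"
  shows "flow \<one>\<^bsub>FB7\<^esub> (g [^]\<^bsub>FB7\<^esub> (n::nat)) = int n * flow \<one>\<^bsub>FB7\<^esub> g"
proof (induction n)
  case (Suc n)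
  have "g [^]\<^bsub>FB7\<^esub> Suc n = g \<star> g [^]\<^bsub>FB7\<^esub> n"
    using assms by (intro FB7.P.nat_pow_Suc2) simp
  then show ?case using assms Suc by (simp add: flow_mult algebra_simps)
qed (simp add: flow_one)

text \<open>Change of base point. Expanding both sides of \<open>g h = h k\<close>, the path of
  \<open>h\<close> occurs once on each side, on the left translated by the pure element
  \<open>g\<close>, which preserves its weight; so it cancels.\<close>

lemma flow_conj:
  assumes "g \<in> carrier PFB7" "h \<in> carrier FB7"
  shows "flow \<one>\<^bsub>FB7\<^esub> g = flow h (FB7_inv h \<star> g \<star> h)"
proof -
  define k where "k = FB7_inv h \<star> g \<star> h"
  have g: "g \<in> carrier FB7" and k: "k \<in> carrier FB7" using assms by (auto simp: k_def)
  have "g \<star> h = h \<star> k" using g assms(2) by (simp add: k_def FB7.P.m_assoc[symmetric])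
  then have "edges.pair edge_weight (edge_path 3 (g \<star> h)) = edges.pair edge_weight (edge_path 3 (h \<star> k))"
    by simp
  moreover have "edges.pair edge_weight (edges.shift 3 g (edge_path 3 h))
      = edges.pair edge_weight (edge_path 3 h)"
    using assms by (intro edge_weight_invariant edge_path_chain)
  moreover have "edges.pair edge_weight (edges.shift 3 h (edge_path 3 k)) = flow h k"
    unfolding flow_def using assms k by (intro edges.pair_shift edge_path_chain)
  ultimately have "edges.pair edge_weight (edge_path 3 g) = flow h k"
    using g k assms(2)
    by (simp add: edge_path_mult edges.pair_add[where t = 3] edge_path_chain edges.shift_chain)
  then show ?thesis using g by (simp add: flow_one_eq k_def)
qed

text \<open>Without the letter 4, every letter changes the count by exactly the change of weight, so
  the count telescopes. In particular it vanishes when \<open>perm g\<close> is the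
  identity.\<close>

lemma flow_parabolic:
  assumes h: "h \<in> carrier FB7" and g: "g \<in> parabolic ({1..6} - {4})"
  shows "flow h g = weight (perm (h \<star> g)) - weight (perm h)"
proof -
  have "flow h (sprod is) = weight (perm (h \<star> sprod is)) - weight (perm h)"
    if "set is \<subseteq> {1..6} - {4}" for "is"
    using that
  proof (induction "is" rule: rev_induct)
    case (snoc i "is")
    then have "is": "set is \<subseteq> {1..6}" "i \<in> {1..6}" and i: "i = 3 \<or> i \<in> {1, 2, 5, 6}"
      and IH: "flow h (sprod is) = weight (perm (h \<star> sprod is)) - weight (perm h)" by auto
    have eq: "h \<star> sprod (is @ [i]) = h \<star> sprod is \<star> \<sigma> i"
      using "is" h by (simp add: sprod_snoc FB7.P.m_assoc)
    show ?case
    proof (cases "i = 3")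
      case True
      then show ?thesis unfolding eq using "is" h IH by (simp add: sprod_snoc flow_mult_sigma(1))
    next
      case False
      with i have "weight (perm (h \<star> sprod is \<star> \<sigma> i)) = weight (perm (h \<star> sprod is))"
        using "is" h by (intro weight_sigma) auto
      then show ?thesis unfolding eq using "is" h IH False by (simp add: sprod_snoc flow_mult_sigma(2))
    qed
  qed (use h in \<open>simp add: flow_one\<close>)
  then show ?thesis using g by (auto simp: parabolic_sprod)
qed

text \<open>In the quotient graph this element runs once around the hexagon of the sets
  \<open>{1, 2, x}\<close> and \<open>{1, 2, x, y}\<close> with \<open>x\<close>, \<open>y\<close>
  in \<open>{3, 4, 5}\<close>, and so crosses the weighted edge once. The weight drops at the first
  letter 3 and is regained at the last letter 4, which is not counted.\<close>

lemma sigma_3_sigma_4_pure: "(\<sigma> 3 \<star> \<sigma> 4) [^]\<^bsub>FB7\<^esub> (3::nat) \<in> carrier PFB7"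
  and flow_sigma_3_sigma_4: "flow \<one>\<^bsub>FB7\<^esub> ((\<sigma> 3 \<star> \<sigma> 4) [^]\<^bsub>FB7\<^esub> (3::nat)) = - 1"
proof -
  have c: "\<sigma> 3 \<in> carrier FB7" "\<sigma> 4 \<in> carrier FB7" by auto
  have p: "perm (\<sigma> 3) = transpose 3 4" "perm (\<sigma> 4) = transpose 4 5"
    using perm_sigma[of 3] perm_sigma[of 4] by auto
  have eq: "(\<sigma> 3 \<star> \<sigma> 4) [^]\<^bsub>FB7\<^esub> (3::nat)
      = \<one>\<^bsub>FB7\<^esub> \<star> \<sigma> 3 \<star> \<sigma> 4 \<star> \<sigma> 3 \<star> \<sigma> 4 \<star> \<sigma> 3 \<star> \<sigma> 4"
    using c by (simp add: numeral_3_eq_3 FB7.P.m_assoc)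
  show "(\<sigma> 3 \<star> \<sigma> 4) [^]\<^bsub>FB7\<^esub> (3::nat) \<in> carrier PFB7"
    unfolding eq using c by (simp add: perm_mult p fun_eq_iff transpose_def)
  show "flow \<one>\<^bsub>FB7\<^esub> ((\<sigma> 3 \<star> \<sigma> 4) [^]\<^bsub>FB7\<^esub> (3::nat)) = - 1"
  proof -
    have "flow \<one>\<^bsub>FB7\<^esub> (\<one>\<^bsub>FB7\<^esub> \<star> \<sigma> 3) = - 1"
      using c by (subst flow_mult_sigma(1)) (auto simp: flow_one p perm_one weight_def transpose_def)
    \<comment> \<open>After three letters the permutation fixes 4 again, but sends
      \<open>{1, 2, 3}\<close> to \<open>{1, 2, 5}\<close>; the weight is still 0 there.\<close>
    moreover have "{Suc 0, 2, 5} \<noteq> {Suc 0, 2, 3}" by auto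
    ultimately show ?thesis
      unfolding eq using c by (simp add: flow_mult_sigma perm_mult p weight_def transpose_def)
  qed
qed

text \<open>A power of \<open>y\<close> fixing an edge \<open>b \<star> parabolic {1, 2, 6}\<close> is killed by the retraction
  onto \<open>parabolic {5, 6}\<close> up to squaring, while \<open>y\<^sup>2\<close> lies in \<open>parabolic {5, 6}\<close>.\<close>

lemma no_periodic_edge:
  assumes y: "y \<in> parabolic {1, 5, 6}" and b: "b \<in> carrier FB7"
    and n: "FB7_inv b \<star> y [^]\<^bsub>FB7\<^esub> n \<star> b \<in> parabolic {1, 2, 6}"
  shows "y [^]\<^bsub>FB7\<^esub> (2 * n :: nat) = \<one>\<^bsub>FB7\<^esub>"
proof -
  have sub: "{1, 5, 6} \<subseteq> {1..6::nat}" "{1, 2, 6} \<subseteq> {1..6::nat}" by auto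
  obtain \<rho> where \<rho>: "\<rho> \<in> hom FB7 FB7"
    "\<And>i. i \<in> {1..6} \<Longrightarrow> \<rho> (\<sigma> i) = (if i \<in> {5, 6} then \<sigma> i else \<one>\<^bsub>FB7\<^esub>)"
    using retraction_hom by metis
  interpret \<rho>: group_hom FB7 FB7 \<rho>
    using \<rho>(1) by (intro group_hom.intro group_hom_axioms.intro FB7.P.is_group)
  have yc: "y \<in> carrier FB7" using parabolic_closed[OF sub(1) y] .
  have s1: "\<sigma> 1 \<in> carrier FB7" "\<sigma> 1 \<star> \<sigma> 1 = \<one>\<^bsub>FB7\<^esub>" using sigma_sq[of 1] by auto
  \<comment> \<open>Since \<open>\<sigma> 1\<close> commutes with \<open>\<sigma> 5\<close> and
    \<open>\<sigma> 6\<close>, an element of \<open>parabolic {1, 5, 6}\<close> differs from its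
    image under \<rho> by at most a central involution \<open>\<sigma> 1\<close>, which squaring
    removes.\<close>
  have "\<sigma> 1 \<star> \<rho> (sprod is) = \<rho> (sprod is) \<star> \<sigma> 1 \<and>
      (sprod is = \<rho> (sprod is) \<or> sprod is = \<sigma> 1 \<star> \<rho> (sprod is))" if "set is \<subseteq> {1, 5, 6}" for "is"
    using that
  proof (induction "is")
    case (Cons i "is")
    then have i: "i \<in> {1, 5, 6}" and "is": "set is \<subseteq> {1, 5, 6}" by auto
    have c: "sprod is \<in> carrier FB7" "\<rho> (sprod is) \<in> carrier FB7"
      using sprod_closed[OF subset_trans[OF "is" sub(1)]] by simp_all
    from i consider "i = 1" | "i \<in> {5, 6}" by auto
    then show ?case
    proof cases
      case 1
      then have "\<rho> (sprod (i # is)) = \<rho> (sprod is)" using c \<rho>(2)[of 1] by simp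
      moreover have "\<sigma> 1 \<star> (\<sigma> 1 \<star> \<rho> (sprod is)) = \<rho> (sprod is)"
        using c s1 by (simp add: FB7.P.m_assoc[symmetric])
      ultimately show ?thesis using Cons.IH[OF "is"] 1 by auto
    next
      case 2
      then have ic: "\<sigma> i \<in> carrier FB7" by auto
      have comm: "\<sigma> 1 \<star> \<sigma> i = \<sigma> i \<star> \<sigma> 1" using 2 by (intro sigma_comm) auto
      have "\<rho> (sprod (i # is)) = \<sigma> i \<star> \<rho> (sprod is)" using c ic 2 \<rho>(2)[of i] by auto
      moreover have "\<sigma> 1 \<star> (\<sigma> i \<star> \<rho> (sprod is)) = \<sigma> i \<star> (\<sigma> 1 \<star> \<rho> (sprod is))"
        using c ic s1 comm by (simp add: FB7.P.m_assoc[symmetric])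
      moreover have "\<sigma> i \<star> (\<rho> (sprod is) \<star> \<sigma> 1) = \<sigma> i \<star> \<rho> (sprod is) \<star> \<sigma> 1"
        using c ic s1 by (simp add: FB7.P.m_assoc)
      ultimately show ?thesis using Cons.IH[OF "is"] by auto
    qed
  qed (use s1 in simp)
  then have "\<sigma> 1 \<star> \<rho> y = \<rho> y \<star> \<sigma> 1" and "y = \<rho> y \<or> y = \<sigma> 1 \<star> \<rho> y"
    using y sub by (auto simp: parabolic_sprod)
  then have sq: "y \<star> y = \<rho> y \<star> \<rho> y"
  proof (elim disjE)
    assume comm: "\<sigma> 1 \<star> \<rho> y = \<rho> y \<star> \<sigma> 1" and eq: "y = \<sigma> 1 \<star> \<rho> y"
    have "(\<sigma> 1 \<star> \<rho> y) \<star> (\<sigma> 1 \<star> \<rho> y) = (\<sigma> 1 \<star> \<rho> y) \<star> (\<rho> y \<star> \<sigma> 1)" by (simp only: comm)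
    also have "\<dots> = (\<rho> y \<star> \<sigma> 1) \<star> (\<sigma> 1 \<star> \<rho> y)"
      using yc s1 comm by (metis FB7.P.m_assoc FB7.P.m_closed \<rho>.hom_closed)
    also have "\<dots> = \<rho> y \<star> (\<sigma> 1 \<star> \<sigma> 1) \<star> \<rho> y"
      using yc s1(1) by (simp only: FB7.P.m_assoc FB7.P.m_closed \<rho>.hom_closed)
    finally show ?thesis using eq yc s1(2) by simp
  qed simp
  \<comment> \<open>Of the letters 1, 2, 6 only 6 survives \<rho>, so the image has at most two
    elements.\<close>
  have sq_one: "\<rho> k \<star> \<rho> k = \<one>\<^bsub>FB7\<^esub>" if k: "k \<in> parabolic {1, 2, 6}" for k
  proof -
    have "\<rho> (sprod is) \<in> {\<one>\<^bsub>FB7\<^esub>, \<sigma> 6}" if "set is \<subseteq> {1, 2, 6}" for "is"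
      using that
    proof (induction "is")
      case (Cons i "is")
      then have "is": "set is \<subseteq> {1, 2, 6}" by auto
      then have c: "\<rho> (sprod is) \<in> {\<one>\<^bsub>FB7\<^esub>, \<sigma> 6}" "sprod is \<in> carrier FB7" "i \<in> {1..6}" "i \<in> {1, 2, 6}"
        using Cons sprod_closed[OF subset_trans[OF "is" sub(2)]] by auto
      then have "\<rho> (sprod (i # is)) = \<rho> (\<sigma> i) \<star> \<rho> (sprod is)" by simp
      moreover have "\<rho> (\<sigma> i) = \<one>\<^bsub>FB7\<^esub> \<or> \<rho> (\<sigma> i) = \<sigma> 6" using c(3,4) \<rho>(2) by auto
      ultimately show ?case using c(1) sigma_sq[of 6] by auto
    qed simp
    then have "\<rho> k = \<one>\<^bsub>FB7\<^esub> \<or> \<rho> k = \<sigma> 6" using k sub by (auto simp: parabolic_sprod)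
    then show ?thesis using sigma_sq[of 6] by auto
  qed
  let ?z = "y [^]\<^bsub>FB7\<^esub> n"
  have zc: "?z \<in> carrier FB7" using yc by simp
  have "FB7_inv (\<rho> b) \<star> (\<rho> ?z \<star> \<rho> ?z) \<star> \<rho> b
      = (FB7_inv (\<rho> b) \<star> \<rho> ?z \<star> \<rho> b) \<star> (FB7_inv (\<rho> b) \<star> \<rho> ?z \<star> \<rho> b)"
  proof -
    have "(FB7_inv (\<rho> b) \<star> \<rho> ?z \<star> \<rho> b) \<star> (FB7_inv (\<rho> b) \<star> \<rho> ?z \<star> \<rho> b)
        = FB7_inv (\<rho> b) \<star> \<rho> ?z \<star> (\<rho> b \<star> FB7_inv (\<rho> b)) \<star> \<rho> ?z \<star> \<rho> b"
      using zc b by (simp only: FB7.P.m_assoc FB7.P.m_closed FB7.P.inv_closed \<rho>.hom_closed)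
    then show ?thesis using zc b by (simp add: FB7.P.m_assoc)
  qed
  also have "\<dots> = \<one>\<^bsub>FB7\<^esub>" using sq_one[OF n] zc b by simp
  finally have conj_one: "FB7_inv (\<rho> b) \<star> (\<rho> ?z \<star> \<rho> ?z) \<star> \<rho> b = \<one>\<^bsub>FB7\<^esub>" .
  have "\<rho> ?z \<star> \<rho> ?z = \<rho> b \<star> (FB7_inv (\<rho> b) \<star> (\<rho> ?z \<star> \<rho> ?z) \<star> \<rho> b) \<star> FB7_inv (\<rho> b)"
  proof -
    have "\<rho> b \<star> (FB7_inv (\<rho> b) \<star> (\<rho> ?z \<star> \<rho> ?z) \<star> \<rho> b) \<star> FB7_inv (\<rho> b)
        = (\<rho> b \<star> FB7_inv (\<rho> b)) \<star> (\<rho> ?z \<star> \<rho> ?z) \<star> (\<rho> b \<star> FB7_inv (\<rho> b))"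
      using zc b by (simp only: FB7.P.m_assoc FB7.P.m_closed FB7.P.inv_closed \<rho>.hom_closed)
    then show ?thesis using zc b by simp
  qed
  then have "\<rho> ?z \<star> \<rho> ?z = \<one>\<^bsub>FB7\<^esub>" unfolding conj_one using b by simp
  \<comment> \<open>\<open>y\<close> and \<open>\<rho> y\<close> have the same square, so
    \<open>y^(2n)\<close> is the square of \<open>\<rho> (y^n)\<close>, which was just shown to be
    trivial.\<close>
  moreover have "?z \<star> ?z = \<rho> ?z \<star> \<rho> ?z"
  proof -
    have "?z \<star> ?z = (y \<star> y) [^]\<^bsub>FB7\<^esub> n" using yc by (simp add: FB7.P.pow_mult_distrib)
    also have "\<dots> = \<rho> ?z \<star> \<rho> ?z" unfolding sq using yc by (simp add: FB7.P.pow_mult_distrib \<rho>.hom_nat_pow)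
    finally show ?thesis .
  qed
  moreover have "y [^]\<^bsub>FB7\<^esub> (2 * n) = ?z \<star> ?z" using yc by (simp add: FB7.P.nat_pow_mult mult_2)
  ultimately show ?thesis by simp
qed

text \<open>If the pair acts freely on \<open>edges 3\<close>, then \<open>edge_path 3\<close> is inner on it. Otherwise, up to
  conjugation, \<open>u\<close> centralises an element of infinite order of \<open>parabolic {1, 5, 6}\<close>, which forces
  it into a vertex stabiliser.\<close>

lemma flow_independent:
  assumes u: "u \<in> carrier PFB7" and v: "v \<in> carrier FB7" and comm: "u \<star> v = v \<star> u"
    and ind: "FB7.P.independent u v"
  shows "flow \<one>\<^bsub>FB7\<^esub> u = 0"
proof (cases "\<forall>x\<in>edges 3. \<forall>(i::nat) (j::nat) (i'::nat) (j'::nat).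
    (FB7_inv u [^]\<^bsub>FB7\<^esub> i \<star> FB7_inv v [^]\<^bsub>FB7\<^esub> j) <#\<^bsub>FB7\<^esub> x
      = (FB7_inv u [^]\<^bsub>FB7\<^esub> i' \<star> FB7_inv v [^]\<^bsub>FB7\<^esub> j') <#\<^bsub>FB7\<^esub> x \<longrightarrow> i = i' \<and> j = j'")
  case True
  have D: "edges.derivation 3 (edge_path 3)" by (intro edge_path(1)) simp
  have uc: "u \<in> carrier FB7" using u by simp
  have free: "i = i' \<and> j = j'" if "x \<in> edges 3"
    "(FB7_inv u [^]\<^bsub>FB7\<^esub> i \<star> FB7_inv v [^]\<^bsub>FB7\<^esub> j) <#\<^bsub>FB7\<^esub> x
      = (FB7_inv u [^]\<^bsub>FB7\<^esub> i' \<star> FB7_inv v [^]\<^bsub>FB7\<^esub> j') <#\<^bsub>FB7\<^esub> x" for x and i j i' j' :: nat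
    using True that by blast
  obtain m where m: "m \<in> edges.chains 3" "edge_path 3 u = (\<lambda>x. edges.shift 3 u m x - m x)"
    by (rule edges.derivation_inner_on_free_pair[OF D uc v comm]) (assumption | erule free | blast)+
  \<comment> \<open>The weight is invariant under the pure element \<open>u\<close>, so pairing it
    with a coboundary of \<open>u\<close> gives 0.\<close>
  then show ?thesis
    using u by (simp add: flow_one_eq edges.pair_diff[where t = 3] edges.shift_chain edge_weight_invariant)
next
  case False
  have uc: "u \<in> carrier FB7" using u by simp
  from False obtain h i j i' j' where h: "h \<in> carrier FB7"
    and eq: "(FB7_inv u [^]\<^bsub>FB7\<^esub> (i::nat) \<star> FB7_inv v [^]\<^bsub>FB7\<^esub> (j::nat)) <#\<^bsub>FB7\<^esub> edge 3 h
      = (FB7_inv u [^]\<^bsub>FB7\<^esub> (i'::nat) \<star> FB7_inv v [^]\<^bsub>FB7\<^esub> (j'::nat)) <#\<^bsub>FB7\<^esub> edge 3 h"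
    and ne: "\<not> (i = i' \<and> j = j')" by blast
  define P where "P = FB7_inv u [^]\<^bsub>FB7\<^esub> i \<star> FB7_inv v [^]\<^bsub>FB7\<^esub> j"
  define Q where "Q = FB7_inv u [^]\<^bsub>FB7\<^esub> i' \<star> FB7_inv v [^]\<^bsub>FB7\<^esub> j'"
  \<comment> \<open>\<open>P\<close> and \<open>Q\<close> move the edge of \<open>h\<close> equally,
    so \<open>z\<close> fixes it; \<open>z\<close> commutes with \<open>u\<close> and has infinite
    order by independence. Conjugating by \<open>h\<close> carries \<open>z\<close> to
    \<open>y\<close> in the stabiliser of the base edge and \<open>u\<close> to
    \<open>g\<close>.\<close>
  define z where "z = FB7_inv Q \<star> P"
  define y where "y = FB7_inv h \<star> z \<star> h"
  define g where "g = FB7_inv h \<star> u \<star> h"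
  have c: "P \<in> carrier FB7" "Q \<in> carrier FB7" "z \<in> carrier FB7" "y \<in> carrier FB7" "g \<in> carrier FB7"
    using uc v h by (simp_all add: P_def Q_def z_def y_def g_def)
  have cinv: "FB7_inv u \<star> FB7_inv v = FB7_inv v \<star> FB7_inv u" "FB7_inv u \<star> u = u \<star> FB7_inv u"
    "FB7_inv v \<star> u = u \<star> FB7_inv v"
  proof -
    show "FB7_inv u \<star> FB7_inv v = FB7_inv v \<star> FB7_inv u" using uc v comm by (simp add: FB7.P.inv_mult_group[symmetric])
    show "FB7_inv u \<star> u = u \<star> FB7_inv u" using uc by simp
    show "FB7_inv v \<star> u = u \<star> FB7_inv v" using uc v comm
      by (metis FB7.P.inv_closed FB7.P.inv_solve_left FB7.P.inv_solve_right FB7.P.m_assoc FB7.P.m_closed)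
  qed
  have pows: "FB7_inv u [^]\<^bsub>FB7\<^esub> a \<star> FB7_inv v [^]\<^bsub>FB7\<^esub> b = FB7_inv v [^]\<^bsub>FB7\<^esub> b \<star> FB7_inv u [^]\<^bsub>FB7\<^esub> a" for a b :: nat
    using uc v cinv by (intro FB7.P.pow_commutes FB7.P.pow_commutes[symmetric]) auto
  have Pu: "(FB7_inv u [^]\<^bsub>FB7\<^esub> a \<star> FB7_inv v [^]\<^bsub>FB7\<^esub> b) \<star> u = u \<star> (FB7_inv u [^]\<^bsub>FB7\<^esub> a \<star> FB7_inv v [^]\<^bsub>FB7\<^esub> b)" for a b :: nat
  proof -
    have "FB7_inv u [^]\<^bsub>FB7\<^esub> a \<star> u = u \<star> FB7_inv u [^]\<^bsub>FB7\<^esub> a" "FB7_inv v [^]\<^bsub>FB7\<^esub> b \<star> u = u \<star> FB7_inv v [^]\<^bsub>FB7\<^esub> b"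
      by (rule FB7.P.pow_commutes[OF FB7.P.inv_closed[OF uc] uc cinv(2)],
          rule FB7.P.pow_commutes[OF FB7.P.inv_closed[OF v] uc cinv(3)])
    then show ?thesis using uc v
      by (metis FB7.P.inv_closed FB7.P.m_assoc FB7.P.nat_pow_closed)
  qed
  have PQ: "P \<star> Q = Q \<star> P"
  proof -
    have "P \<star> Q = FB7_inv u [^]\<^bsub>FB7\<^esub> (i + i') \<star> FB7_inv v [^]\<^bsub>FB7\<^esub> (j + j')" if
      "P = FB7_inv u [^]\<^bsub>FB7\<^esub> i \<star> FB7_inv v [^]\<^bsub>FB7\<^esub> j" "Q = FB7_inv u [^]\<^bsub>FB7\<^esub> i' \<star> FB7_inv v [^]\<^bsub>FB7\<^esub> j'"
      for P Q and i j i' j' :: nat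
    proof -
      have "P \<star> Q = FB7_inv u [^]\<^bsub>FB7\<^esub> i \<star> (FB7_inv v [^]\<^bsub>FB7\<^esub> j \<star> FB7_inv u [^]\<^bsub>FB7\<^esub> i') \<star> FB7_inv v [^]\<^bsub>FB7\<^esub> j'"
        using that uc v by (simp add: FB7.P.m_assoc)
      also have "\<dots> = (FB7_inv u [^]\<^bsub>FB7\<^esub> i \<star> FB7_inv u [^]\<^bsub>FB7\<^esub> i') \<star> (FB7_inv v [^]\<^bsub>FB7\<^esub> j \<star> FB7_inv v [^]\<^bsub>FB7\<^esub> j')"
        unfolding pows[symmetric] using uc v by (simp add: FB7.P.m_assoc)
      finally show ?thesis using uc v by (simp add: FB7.P.nat_pow_mult)
    qed
    from this[OF P_def Q_def] this[OF Q_def P_def] show ?thesis by (simp add: add.commute)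
  qed
  have zu: "z \<star> u = u \<star> z"
  proof -
    have "Q \<star> u = u \<star> Q" unfolding Q_def by (rule Pu)
    then have "FB7_inv Q \<star> u = u \<star> FB7_inv Q"
      using c uc by (metis FB7.P.inv_closed FB7.P.inv_solve_left FB7.P.inv_solve_right FB7.P.m_assoc FB7.P.m_closed)
    moreover have "P \<star> u = u \<star> P" unfolding P_def by (rule Pu)
    ultimately show ?thesis unfolding z_def using c uc by (metis FB7.P.inv_closed FB7.P.m_assoc)
  qed
  have z_inf: "z [^]\<^bsub>FB7\<^esub> n \<noteq> \<one>\<^bsub>FB7\<^esub>" if "n > 0" for n :: nat
  proof
    assume z1: "z [^]\<^bsub>FB7\<^esub> n = \<one>\<^bsub>FB7\<^esub>"
    have "Q \<star> z = P" using c by (simp add: z_def FB7.P.m_assoc[symmetric])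
    moreover have "z \<star> Q = P" using c PQ by (simp add: z_def FB7.P.m_assoc) (simp add: FB7.P.m_assoc[symmetric])
    ultimately have "P [^]\<^bsub>FB7\<^esub> n = Q [^]\<^bsub>FB7\<^esub> n \<star> z [^]\<^bsub>FB7\<^esub> n"
      using c FB7.P.pow_mult_distrib[of Q z n] by simp
    then have "P [^]\<^bsub>FB7\<^esub> n = Q [^]\<^bsub>FB7\<^esub> n" using z1 c by simp
    then have "FB7_inv u [^]\<^bsub>FB7\<^esub> (i * n) \<star> FB7_inv v [^]\<^bsub>FB7\<^esub> (j * n)
        = FB7_inv u [^]\<^bsub>FB7\<^esub> (i' * n) \<star> FB7_inv v [^]\<^bsub>FB7\<^esub> (j' * n)"
      unfolding P_def Q_def using uc v pows by (simp add: FB7.P.pow_mult_distrib FB7.P.nat_pow_pow)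
    then have "i * n = i' * n \<and> j * n = j' * n"
      using FB7.P.independent_inv[OF uc v comm ind] unfolding FB7.P.independent_def by blast
    with that ne show False by simp
  qed
  have y_pow: "y [^]\<^bsub>FB7\<^esub> n = FB7_inv h \<star> z [^]\<^bsub>FB7\<^esub> n \<star> h" for n :: nat
    using FB7.P.pow_conj[of "FB7_inv h" z n] h c by (simp add: y_def)
  have y_inf: "y [^]\<^bsub>FB7\<^esub> n \<noteq> \<one>\<^bsub>FB7\<^esub>" if "n > 0" for n :: nat
  proof
    assume "y [^]\<^bsub>FB7\<^esub> n = \<one>\<^bsub>FB7\<^esub>"
    then have "h \<star> (FB7_inv h \<star> z [^]\<^bsub>FB7\<^esub> n \<star> h) \<star> FB7_inv h = \<one>\<^bsub>FB7\<^esub>"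
      using y_pow h by simp
    moreover have "h \<star> (FB7_inv h \<star> z [^]\<^bsub>FB7\<^esub> n \<star> h) \<star> FB7_inv h
        = (h \<star> FB7_inv h) \<star> z [^]\<^bsub>FB7\<^esub> n \<star> (h \<star> FB7_inv h)"
      using h c by (simp only: FB7.P.m_assoc FB7.P.m_closed FB7.P.inv_closed FB7.P.nat_pow_closed)
    ultimately show False using z_inf[OF that] h c by simp
  qed
  have y: "y \<in> parabolic {1, 5, 6}"
  proof -
    have "FB7_inv Q <#\<^bsub>FB7\<^esub> edge 3 (P \<star> h) = FB7_inv Q <#\<^bsub>FB7\<^esub> edge 3 (Q \<star> h)"
      using eq c h by (simp add: act_edge P_def[symmetric] Q_def[symmetric])
    then have "edge 3 (z \<star> h) = edge 3 h"
      using c h by (simp add: act_edge z_def FB7.P.m_assoc[symmetric])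
    then show ?thesis using edge_eq_iff[of "z \<star> h" h 3] c h
      by (simp add: y_def link_3 FB7.P.m_assoc)
  qed
  have yg: "y \<star> g = g \<star> y"
  proof -
    have "y \<star> g = FB7_inv h \<star> z \<star> (h \<star> FB7_inv h) \<star> u \<star> h" "g \<star> y = FB7_inv h \<star> u \<star> (h \<star> FB7_inv h) \<star> z \<star> h"
      unfolding y_def g_def using c h uc by (simp_all only: FB7.P.m_assoc FB7.P.m_closed FB7.P.inv_closed)
    then show ?thesis using zu c h uc by (simp add: FB7.P.m_assoc)
  qed
  \<comment> \<open>Here the second tree enters: the path of \<open>y\<close> for
    \<open>t = 4\<close> is empty, so expanding \<open>y g = g y\<close> makes the path of
    \<open>g\<close> invariant under \<open>y\<close>.\<close>
  have Dy: "edge_path 4 y = (\<lambda>_. 0)"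
    using y parabolic_mono[of "{1, 5, 6}" "{1..6} - {4}"] by (intro edge_path_parabolic) auto
  have "edges.shift 4 y (edge_path 4 g) = edge_path 4 g"
    using edge_path_mult[of 4 y g] edge_path_mult[of 4 g y] yg Dy c by simp
  moreover have gch: "edge_path 4 g \<in> edges.chains 4"
    using c by (intro edges.derivation_chain edge_path(1)) auto
  \<comment> \<open>An edge on this finite invariant path would be fixed by a positive power of
    \<open>y\<close>, and \<open>no_periodic_edge\<close> would then give \<open>y\<close> finite
    order.\<close>
  ultimately have "edge_path 4 g x = 0" for x
  proof (rule_tac ccontr)
    assume inv: "edges.shift 4 y (edge_path 4 g) = edge_path 4 g" and x: "edge_path 4 g x \<noteq> 0"
    obtain n where n: "n > (0::nat)" "y [^]\<^bsub>FB7\<^esub> n <#\<^bsub>FB7\<^esub> x = x"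
      using edges.invariant_chain_periodic[OF gch c(4) inv x] by blast
    have "x \<in> edges 4" using edges.chainsD(2)[OF gch] x by blast
    then obtain b where b: "b \<in> carrier FB7" "x = edge 4 b" by auto
    then have "edge 4 (y [^]\<^bsub>FB7\<^esub> n \<star> b) = edge 4 b" using n(2) c by (simp add: act_edge)
    then have "FB7_inv b \<star> (y [^]\<^bsub>FB7\<^esub> n \<star> b) \<in> parabolic {1, 2, 6}"
      using edge_eq_iff[of "y [^]\<^bsub>FB7\<^esub> n \<star> b" b 4] b(1) c by (simp add: link_4)
    then have "y [^]\<^bsub>FB7\<^esub> (2 * n) = \<one>\<^bsub>FB7\<^esub>"
      using b c by (intro no_periodic_edge[OF y b(1)]) (simp add: FB7.P.m_assoc)
    then show False using y_inf[of "2 * n"] n(1) by simp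
  qed
  then have gB: "g \<in> parabolic ({1..6} - {4})"
    using c by (intro edge_path_zero_imp_parabolic) auto
  \<comment> \<open>Now \<open>g\<close> lies in a vertex stabiliser and is pure, so the count based
    at \<open>h\<close> telescopes to 0.\<close>
  have "perm g = id" unfolding g_def using u h by (intro perm_conj) auto
  then have "perm (h \<star> g) = perm h" using h c by (simp add: perm_mult)
  then show ?thesis using flow_conj[OF u h] flow_parabolic[OF h gB] by (simp add: g_def)
qed

section \<open>Independent powers of products of neighbouring generators\<close>

lemma sigma_pair_hom:
  assumes i: "i \<in> {1..6}" "k \<in> {1..6}" "k = Suc i"
  obtains \<tau> where "\<tau> \<in> hom FB7 FB7" "\<And>j. j \<in> {1..6} - {i, k} \<Longrightarrow> \<tau> (\<sigma> j) = \<one>\<^bsub>FB7\<^esub>"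
    "\<tau> (\<sigma> i \<star> \<sigma> k) = \<sigma> 3 \<star> \<sigma> 4"
proof -
  define \<phi> where "\<phi> j = (if j = i then \<sigma> 3 else if j = k then \<sigma> 4 else \<one>\<^bsub>FB7\<^esub>)" for j
  have \<phi>_closed: "\<phi> j \<in> carrier FB7" for j by (simp add: \<phi>_def)
  obtain \<tau> where \<tau>: "\<tau> \<in> hom FB7 FB7" "\<And>j. j \<in> {1..6} \<Longrightarrow> \<tau> (\<sigma> j) = \<phi> j"
  proof (rule FB7_hom[OF FB7.P.is_group, of \<phi>])
    show "\<phi> \<in> {1..6} \<rightarrow> carrier FB7" using \<phi>_closed by blast
    show "\<phi> j \<star> \<phi> j = \<one>\<^bsub>FB7\<^esub>" for j by (simp add: \<phi>_def sigma_sq)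
    fix j l :: nat assume "j + 2 \<le> l"
    \<comment> \<open>No commutation relation involves both \<open>i\<close> and
      \<open>k = Suc i\<close>, so one of the two letters is sent to the identity.\<close>
    then have "\<phi> j = \<one>\<^bsub>FB7\<^esub> \<or> \<phi> l = \<one>\<^bsub>FB7\<^esub>" using i(3) by (simp add: \<phi>_def)
    then show "\<phi> j \<star> \<phi> l = \<phi> l \<star> \<phi> j"
      by (elim disjE) (simp_all add: \<phi>_closed)
  qed blast
  show thesis
  proof (rule that[OF \<tau>(1)])
    show "\<tau> (\<sigma> j) = \<one>\<^bsub>FB7\<^esub>" if "j \<in> {1..6} - {i, k}" for j
      using that \<tau>(2) by (simp add: \<phi>_def)
    show "\<tau> (\<sigma> i \<star> \<sigma> k) = \<sigma> 3 \<star> \<sigma> 4"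
      using hom_mult[OF \<tau>(1) sigma_closed[OF i(1)] sigma_closed[OF i(2)]] \<tau>(2) i by (simp add: \<phi>_def)
  qed
qed

text \<open>Infinite order is detected by \<open>flow\<close>, which is additive on powers of the
  pure cube and takes the value -1 on it.\<close>

lemma sigma_3_sigma_4_pow_inj:
  assumes "(\<sigma> 3 \<star> \<sigma> 4) [^]\<^bsub>FB7\<^esub> (i::nat) = (\<sigma> 3 \<star> \<sigma> 4) [^]\<^bsub>FB7\<^esub> (j::nat)"
  shows "i = j"
proof -
  let ?a = "\<sigma> 3 \<star> \<sigma> 4"
  have "(?a [^]\<^bsub>FB7\<^esub> (3::nat)) [^]\<^bsub>FB7\<^esub> k = (?a [^]\<^bsub>FB7\<^esub> k) [^]\<^bsub>FB7\<^esub> (3::nat)" for k :: nat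
    by (simp add: FB7.P.nat_pow_pow mult.commute)
  with assms have "(?a [^]\<^bsub>FB7\<^esub> (3::nat)) [^]\<^bsub>FB7\<^esub> i = (?a [^]\<^bsub>FB7\<^esub> (3::nat)) [^]\<^bsub>FB7\<^esub> j"
    by simp
  then have "int i * - 1 = int j * - 1"
    using flow_pow[OF sigma_3_sigma_4_pure] by (metis flow_sigma_3_sigma_4)
  then show ?thesis by simp
qed

text \<open>One homomorphism carries \<open>\<sigma> 1 \<star> \<sigma> 2\<close> to
  \<open>\<sigma> 3 \<star> \<sigma> 4\<close> and kills the other factor, a second one does the
  reverse; each recovers one exponent.\<close>

lemma pow_sigma_independent:
  assumes "k > 0"
  shows "FB7.P.independent ((\<sigma> 1 \<star> \<sigma> 2) [^]\<^bsub>FB7\<^esub> (k::nat)) ((\<sigma> 5 \<star> \<sigma> 6) [^]\<^bsub>FB7\<^esub> k)"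
  unfolding FB7.P.independent_def
proof (intro allI impI)
  fix i j i' j' :: nat
  let ?a = "\<sigma> 1 \<star> \<sigma> 2" and ?b = "\<sigma> 5 \<star> \<sigma> 6"
  have c: "?a \<in> carrier FB7" "?b \<in> carrier FB7" by auto
  assume "(?a [^]\<^bsub>FB7\<^esub> k) [^]\<^bsub>FB7\<^esub> i \<star> (?b [^]\<^bsub>FB7\<^esub> k) [^]\<^bsub>FB7\<^esub> j
    = (?a [^]\<^bsub>FB7\<^esub> k) [^]\<^bsub>FB7\<^esub> i' \<star> (?b [^]\<^bsub>FB7\<^esub> k) [^]\<^bsub>FB7\<^esub> j'"
  then have eq: "?a [^]\<^bsub>FB7\<^esub> (k * i) \<star> ?b [^]\<^bsub>FB7\<^esub> (k * j) = ?a [^]\<^bsub>FB7\<^esub> (k * i') \<star> ?b [^]\<^bsub>FB7\<^esub> (k * j')"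
    using c by (simp add: FB7.P.nat_pow_pow)
  have pow: "\<tau> (?a [^]\<^bsub>FB7\<^esub> (m::nat) \<star> ?b [^]\<^bsub>FB7\<^esub> (n::nat)) = \<tau> ?a [^]\<^bsub>FB7\<^esub> m \<star> \<tau> ?b [^]\<^bsub>FB7\<^esub> n"
    if "\<tau> \<in> hom FB7 FB7" for \<tau> m n
  proof -
    interpret \<tau>: group_hom FB7 FB7 \<tau>
      using that by (intro group_hom.intro group_hom_axioms.intro FB7.P.is_group)
    show ?thesis using c by (simp add: \<tau>.hom_nat_pow del: \<tau>.hom_mult) (simp add: \<tau>.hom_nat_pow)
  qed
  obtain \<tau>1 where \<tau>1: "\<tau>1 \<in> hom FB7 FB7" "\<And>j. j \<in> {1..6} - {1, 2} \<Longrightarrow> \<tau>1 (\<sigma> j) = \<one>\<^bsub>FB7\<^esub>"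
    "\<tau>1 ?a = \<sigma> 3 \<star> \<sigma> 4"
    by (rule sigma_pair_hom[of 1 2]) (simp, simp, simp, blast)
  obtain \<tau>2 where \<tau>2: "\<tau>2 \<in> hom FB7 FB7" "\<And>j. j \<in> {1..6} - {5, 6} \<Longrightarrow> \<tau>2 (\<sigma> j) = \<one>\<^bsub>FB7\<^esub>"
    "\<tau>2 ?b = \<sigma> 3 \<star> \<sigma> 4"
    by (rule sigma_pair_hom[of 5 6]) (simp, simp, simp, blast)
  have b: "\<tau>1 ?b = \<one>\<^bsub>FB7\<^esub>" using hom_mult[OF \<tau>1(1), of "\<sigma> 5" "\<sigma> 6"] \<tau>1(2)[of 5] \<tau>1(2)[of 6] by simp
  have "(\<sigma> 3 \<star> \<sigma> 4) [^]\<^bsub>FB7\<^esub> (k * i) = (\<sigma> 3 \<star> \<sigma> 4) [^]\<^bsub>FB7\<^esub> (k * i')"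
    using arg_cong[OF eq, of \<tau>1] unfolding pow[OF \<tau>1(1)] \<tau>1(3) b by simp
  then have 1: "k * i = k * i'" by (rule sigma_3_sigma_4_pow_inj)
  have a: "\<tau>2 ?a = \<one>\<^bsub>FB7\<^esub>" using hom_mult[OF \<tau>2(1), of "\<sigma> 1" "\<sigma> 2"] \<tau>2(2)[of 1] \<tau>2(2)[of 2] by simp
  have "(\<sigma> 3 \<star> \<sigma> 4) [^]\<^bsub>FB7\<^esub> (k * j) = (\<sigma> 3 \<star> \<sigma> 4) [^]\<^bsub>FB7\<^esub> (k * j')"
    using arg_cong[OF eq, of \<tau>2] unfolding pow[OF \<tau>2(1)] \<tau>2(3) a by simp
  then have "k * j = k * j'" by (rule sigma_3_sigma_4_pow_inj)
  with 1 assms show "i = i' \<and> j = j'" by simp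
qed

text \<open>Two neighbouring transpositions multiply to a 3-cycle.\<close>

lemma sigma_pair_cube_pure:
  assumes "i \<in> {1..6}" "k \<in> {1..6}" "k = Suc i"
  shows "perm ((\<sigma> i \<star> \<sigma> k) [^]\<^bsub>FB7\<^esub> (3::nat)) = id"
proof -
  have "(\<sigma> i \<star> \<sigma> k) [^]\<^bsub>FB7\<^esub> (3::nat) = \<sigma> i \<star> \<sigma> k \<star> (\<sigma> i \<star> \<sigma> k) \<star> (\<sigma> i \<star> \<sigma> k)"
    using assms by (simp add: numeral_3_eq_3)
  then show ?thesis
    using assms by (auto simp: perm_mult perm_sigma fun_eq_iff transpose_def)
qed

lemma pow_comm_sigma:
  assumes "i \<in> {1..6}" "j \<in> {1..6}" "k \<in> {1..6}"
    and "i + 2 \<le> j \<or> j + 2 \<le> i" "i + 2 \<le> k \<or> k + 2 \<le> i"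
  shows "\<sigma> i \<star> (\<sigma> j \<star> \<sigma> k) [^]\<^bsub>FB7\<^esub> (n::nat) = (\<sigma> j \<star> \<sigma> k) [^]\<^bsub>FB7\<^esub> n \<star> \<sigma> i"
proof (rule FB7.P.pow_commutes[symmetric])
  have c: "\<sigma> i \<in> carrier FB7" "\<sigma> j \<in> carrier FB7" "\<sigma> k \<in> carrier FB7" using assms by auto
  have ij: "\<sigma> i \<star> \<sigma> j = \<sigma> j \<star> \<sigma> i" and ik: "\<sigma> i \<star> \<sigma> k = \<sigma> k \<star> \<sigma> i"
    using sigma_comm[OF assms(1,2,4)] sigma_comm[OF assms(1,3,5)] by simp_all
  have "\<sigma> j \<star> \<sigma> k \<star> \<sigma> i = \<sigma> j \<star> (\<sigma> i \<star> \<sigma> k)" using c ik by (simp add: FB7.P.m_assoc)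
  also have "\<dots> = \<sigma> i \<star> \<sigma> j \<star> \<sigma> k" using c ij by (simp add: FB7.P.m_assoc[symmetric])
  finally show "\<sigma> j \<star> \<sigma> k \<star> \<sigma> i = \<sigma> i \<star> (\<sigma> j \<star> \<sigma> k)" using c by (simp add: FB7.P.m_assoc)
qed (use assms in auto)

subsection \<open>Right-angled Artin groups\<close>

lemma raag_presented: "presented V (raag_relators V E)"
  by unfold_locales (auto simp: raag_relators_def)

abbreviation vgen :: "'v set \<Rightarrow> ('v \<Rightarrow> 'v \<Rightarrow> bool) \<Rightarrow> 'v \<Rightarrow> 'v word set" where
  "vgen V E \<equiv> gen V (raag_relators V E)"

lemma group_raag: "group (raag V E)"
  unfolding raag_def by (rule presented.group_presentation[OF raag_presented])

lemma vgen_closed: "u \<in> V \<Longrightarrow> vgen V E u \<in> carrier (raag V E)"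
  unfolding raag_def by (rule presented.gen_closed[OF raag_presented])

lemma generate_vgen: "generate (raag V E) (vgen V E ` V) = carrier (raag V E)"
  unfolding raag_def by (rule presented.generate_gen[OF raag_presented])

text \<open>\<open>E\<close> is an arbitrary relation; an edge in either orientation imposes the
  commutation.\<close>

lemma vgen_comm:
  assumes "u \<in> V" "v \<in> V" "E u v \<or> E v u"
  shows "vgen V E u \<otimes>\<^bsub>raag V E\<^esub> vgen V E v = vgen V E v \<otimes>\<^bsub>raag V E\<^esub> vgen V E u"
proof -
  interpret R: group "raag V E" by (rule group_raag)
  have "vgen V E u \<otimes>\<^bsub>raag V E\<^esub> vgen V E v = vgen V E v \<otimes>\<^bsub>raag V E\<^esub> vgen V E u"
    if "u \<in> V" "v \<in> V" "E u v" for u v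
  proof -
    have "[(u, True), (v, True), (u, False), (v, False)] \<in> raag_relators V E"
      using that by (auto simp: raag_relators_def)
    from presented.relator_trivial[OF raag_presented this] show ?thesis
      using that by (intro R.commutator_word_val_one vgen_closed) (simp_all only: raag_def)
  qed
  with assms show ?thesis by metis
qed

lemma word_val_raag_relators:
  assumes "group G" and \<phi>: "\<phi> \<in> V \<rightarrow> carrier G"
    and comm: "\<And>u v. u \<in> V \<Longrightarrow> v \<in> V \<Longrightarrow> E u v \<Longrightarrow> \<phi> u \<otimes>\<^bsub>G\<^esub> \<phi> v = \<phi> v \<otimes>\<^bsub>G\<^esub> \<phi> u"
    and r: "r \<in> raag_relators V E"
  shows "monoid.word_val G \<phi> r = \<one>\<^bsub>G\<^esub>"
proof -
  interpret group G by fact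
  obtain u v where uv: "u \<in> V" "v \<in> V" "E u v" "r = [(u, True), (v, True), (u, False), (v, False)]"
    using r by (auto simp: raag_relators_def)
  then have "\<phi> u \<in> carrier G" "\<phi> v \<in> carrier G" using \<phi> by auto
  then show ?thesis unfolding uv(4) using uv by (intro word_val_commutator comm)
qed

lemma raag_exponent_sum:
  assumes u: "u \<in> V"
  obtains e :: "'v word set \<Rightarrow> int" where "e \<in> hom (raag V E) integer_group"
    "\<And>w. w \<in> V \<Longrightarrow> e (vgen V E w) = of_bool (w = u)"
proof -
  have "monoid.word_val integer_group (\<lambda>w. of_bool (w = u)) r = \<one>\<^bsub>integer_group\<^esub>"
    if "r \<in> raag_relators V E" for r
    using that by (intro word_val_raag_relators[OF group_integer_group]) auto
  from presented.presentation_hom[OF raag_presented[of V E] group_integer_group _ this, folded raag_def]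
  show thesis using that by auto
qed

lemma nat_pow_integer_group: "x [^]\<^bsub>integer_group\<^esub> (n::nat) = int n * x"
  by (induction n) (auto simp: algebra_simps)

text \<open>The exponent sums of \<open>u\<close> and of \<open>v\<close> are invariants of the
  group element and recover the two exponents.\<close>

lemma vgen_independent:
  assumes "u \<in> V" "v \<in> V" "u \<noteq> v"
  shows "monoid.independent (raag V E) (vgen V E u) (vgen V E v)"
proof -
  interpret R: group "raag V E" by (rule group_raag)
  have sum: "e (vgen V E u [^]\<^bsub>raag V E\<^esub> i \<otimes>\<^bsub>raag V E\<^esub> vgen V E v [^]\<^bsub>raag V E\<^esub> j)
      = int i * e (vgen V E u) + int j * e (vgen V E v)"
    if "e \<in> hom (raag V E) integer_group" for e and i j :: nat
  proof -
    interpret e: group_hom "raag V E" integer_group e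
      using that group_raag by (intro group_hom.intro group_hom_axioms.intro) auto
    show ?thesis using assms vgen_closed[of _ V E]
      by (simp add: e.hom_nat_pow nat_pow_integer_group)
  qed
  obtain e1 where e1: "e1 \<in> hom (raag V E) integer_group" "\<And>w. w \<in> V \<Longrightarrow> e1 (vgen V E w) = of_bool (w = u)"
    using raag_exponent_sum[OF assms(1)] by blast
  obtain e2 where e2: "e2 \<in> hom (raag V E) integer_group" "\<And>w. w \<in> V \<Longrightarrow> e2 (vgen V E w) = of_bool (w = v)"
    using raag_exponent_sum[OF assms(2)] by blast
  show ?thesis
    unfolding R.independent_def
  proof (intro allI impI)
    fix i j i' j' :: nat
    assume eq: "vgen V E u [^]\<^bsub>raag V E\<^esub> i \<otimes>\<^bsub>raag V E\<^esub> vgen V E v [^]\<^bsub>raag V E\<^esub> j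
      = vgen V E u [^]\<^bsub>raag V E\<^esub> i' \<otimes>\<^bsub>raag V E\<^esub> vgen V E v [^]\<^bsub>raag V E\<^esub> j'"
    show "i = i' \<and> j = j'"
      using arg_cong[OF eq, of e1] arg_cong[OF eq, of e2] assms
      by (simp add: sum[OF e1(1)] sum[OF e2(1)] e1(2) e2(2))
  qed
qed

text \<open>The Fox derivative with respect to \<open>s\<close> with coefficients in the group ring.
  It respects the relators because none pairs \<open>s\<close> with another vertex.\<close>

lemma fox_derivation:
  assumes s: "s \<in> V" and isolated: "\<And>v. v \<in> V \<Longrightarrow> v \<noteq> s \<Longrightarrow> \<not> E s v \<and> \<not> E v s"
  obtains D where "gset.derivation (raag V E) (carrier (raag V E)) (\<otimes>\<^bsub>raag V E\<^esub>) D"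
    "D (vgen V E s) = (\<lambda>x. of_bool (x = \<one>\<^bsub>raag V E\<^esub>))"
proof -
  interpret R: gset "raag V E" "carrier (raag V E)" "(\<otimes>\<^bsub>raag V E\<^esub>)"
    by (rule group.gset_regular[OF group_raag])
  interpret SD: group R.semidirect by (rule R.group_semidirect)
  define d where "d u = (\<lambda>x. of_bool (u = s \<and> x = \<one>\<^bsub>raag V E\<^esub>) :: int)" for u
  have d: "d \<in> V \<rightarrow> R.chains"
    by (auto simp: d_def R.chains_def)
  have zero: "d u = (\<lambda>_. 0)" if "u \<noteq> s" for u using that by (simp add: d_def)
  have "monoid.word_val R.semidirect (\<lambda>u. (vgen V E u, d u)) r = \<one>\<^bsub>R.semidirect\<^esub>"
    if r: "r \<in> raag_relators V E" for r
  proof (rule word_val_raag_relators[OF SD.is_group _ _ r])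
    show "(\<lambda>u. (vgen V E u, d u)) \<in> V \<rightarrow> carrier R.semidirect"
      using d vgen_closed[of _ V E] by auto
    fix u v assume uv: "u \<in> V" "v \<in> V" "E u v"
    \<comment> \<open>\<open>E\<close> may contain loops; the relator of a loop, even at
      \<open>s\<close>, commutes a generator with itself.\<close>
    then have "u = v \<or> u \<noteq> s \<and> v \<noteq> s" using isolated by blast
    then show "(vgen V E u, d u) \<otimes>\<^bsub>R.semidirect\<^esub> (vgen V E v, d v)
        = (vgen V E v, d v) \<otimes>\<^bsub>R.semidirect\<^esub> (vgen V E u, d u)"
      using uv zero vgen_comm[of u V v E] by auto
  qed
  then have "monoid.word_val R.semidirect (\<lambda>u. (vgen V E u, d u)) r = (\<one>\<^bsub>raag V E\<^esub>, \<lambda>_. 0)"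
    if "r \<in> raag_relators V E" for r
    using that by (simp only: R.semidirect_simps(3))
  then obtain D where "R.derivation D" "\<And>u. u \<in> V \<Longrightarrow> D (vgen V E u) = d u"
    by (rule presented.presentation_derivation[OF raag_presented, folded raag_def, OF R.gset_axioms d])
      (assumption | blast)+
  then show thesis using that s by (simp add: d_def)
qed

section \<open>The contradiction for a finite-index right-angled Artin subgroup\<close>

locale raag_in_PFB7 =
  fixes V :: "'v set" and E :: "'v \<Rightarrow> 'v \<Rightarrow> bool" and H :: "nat word set set"
    and \<theta> :: "nat word set \<Rightarrow> 'v word set"
  assumes sub: "subgroup H PFB7" and fin: "finite (rcosets\<^bsub>PFB7\<^esub> H)"
    and iso: "\<theta> \<in> iso (PFB7\<lparr>carrier := H\<rparr>) (raag V E)"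
begin

lemma H_PFB7: "H \<subseteq> carrier PFB7"
  using sub by (rule subgroup.subset)

lemma H_FB7: "H \<subseteq> carrier FB7"
  using H_PFB7 by auto

lemma group_PFB7: "group PFB7"
  using FB7.P.subgroup_imp_group[OF subgroup_PFB7] PFB7_eq by simp

lemma subgroup_H: "subgroup H FB7"
  using FB7.P.incl_subgroup[OF subgroup_PFB7] sub PFB7_eq by simp

sublocale R: gset "raag V E" "carrier (raag V E)" "(\<otimes>\<^bsub>raag V E\<^esub>)"
  by (rule group.gset_regular[OF group_raag])

lemma restrict_eq: "PFB7\<lparr>carrier := H\<rparr> = FB7\<lparr>carrier := H\<rparr>"
  by (simp add: PFB7_def)

sublocale HG: group "FB7\<lparr>carrier := H\<rparr>"
  by (rule FB7.P.subgroup_imp_group[OF subgroup_H])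

lemma \<theta>_iso: "\<theta> \<in> iso (FB7\<lparr>carrier := H\<rparr>) (raag V E)"
  using iso by (simp add: restrict_eq)

sublocale \<theta>: group_hom "FB7\<lparr>carrier := H\<rparr>" "raag V E" \<theta>
  using \<theta>_iso by unfold_locales (auto simp: iso_def)

definition \<psi> where "\<psi> = inv_into H \<theta>"

lemma \<psi>_iso: "\<psi> \<in> iso (raag V E) (FB7\<lparr>carrier := H\<rparr>)"
  using HG.iso_set_sym[OF \<theta>_iso] by (simp add: \<psi>_def)

sublocale \<psi>: group_hom "raag V E" "FB7\<lparr>carrier := H\<rparr>" \<psi>
  using \<psi>_iso by unfold_locales (auto simp: iso_def)

lemma bij_\<theta>: "bij_betw \<theta> H (carrier (raag V E))"
  using \<theta>_iso by (auto simp: iso_def)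

lemma \<psi>_\<theta>: "x \<in> H \<Longrightarrow> \<psi> (\<theta> x) = x"
  unfolding \<psi>_def using bij_\<theta> by (simp add: bij_betw_def)

lemma \<theta>_\<psi>: "r \<in> carrier (raag V E) \<Longrightarrow> \<theta> (\<psi> r) = r"
  unfolding \<psi>_def using bij_\<theta> by (simp add: bij_betw_def f_inv_into_f)

lemma independent_restrict:
  "monoid.independent (FB7\<lparr>carrier := H\<rparr>) u v \<longleftrightarrow> FB7.P.independent u v"
  unfolding HG.independent_def FB7.P.independent_def
  by (simp add: FB7.P.nat_pow_consistent[symmetric])

lemma \<theta>_independent:
  assumes "u \<in> H" "v \<in> H" "FB7.P.independent u v"
  shows "R.independent (\<theta> u) (\<theta> v)"
  using assms \<theta>.hom_closed by (intro \<psi>.independent_preimage) (simp_all add: \<psi>_\<theta> independent_restrict)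

lemma \<psi>_independent:
  assumes "u \<in> carrier (raag V E)" "v \<in> carrier (raag V E)" "R.independent u v"
  shows "FB7.P.independent (\<psi> u) (\<psi> v)"
  using assms \<psi>.hom_closed \<theta>.independent_preimage[of "\<psi> u" "\<psi> v"]
  by (simp add: \<theta>_\<psi> independent_restrict)

lemma pow_in_H:
  obtains n where "n > (0::nat)" "\<And>g. g \<in> carrier PFB7 \<Longrightarrow> g [^]\<^bsub>FB7\<^esub> n \<in> H"
proof -
  interpret PF: group PFB7 by (rule group_PFB7)
  obtain n where n: "n > (0::nat)" "\<And>g. g \<in> carrier PFB7 \<Longrightarrow> g [^]\<^bsub>PFB7\<^esub> n \<in> H"
    using PF.pow_finite_rcosets[OF sub fin] by blast
  have "g [^]\<^bsub>PFB7\<^esub> n = g [^]\<^bsub>FB7\<^esub> n" for g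
    using FB7.P.nat_pow_consistent[of g n "carrier PFB7"] PFB7_eq by simp
  with n that show thesis by simp
qed

lemma \<psi>_closed: "r \<in> carrier (raag V E) \<Longrightarrow> \<psi> r \<in> H"
  using \<psi>.hom_closed by simp

lemma \<theta>_closed: "x \<in> H \<Longrightarrow> \<theta> x \<in> carrier (raag V E)"
  using \<theta>.hom_closed by simp

lemma \<psi>_mult:
  "r \<in> carrier (raag V E) \<Longrightarrow> s \<in> carrier (raag V E) \<Longrightarrow> \<psi> (r \<otimes>\<^bsub>raag V E\<^esub> s) = \<psi> r \<star> \<psi> s"
  using \<psi>.hom_mult by simp

lemma \<theta>_mult: "x \<in> H \<Longrightarrow> y \<in> H \<Longrightarrow> \<theta> (x \<star> y) = \<theta> x \<otimes>\<^bsub>raag V E\<^esub> \<theta> y"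
  using \<theta>.hom_mult[of x y] by simp

lemma \<theta>_inv: "x \<in> H \<Longrightarrow> \<theta> (FB7_inv x) = inv\<^bsub>raag V E\<^esub> \<theta> x"
  using \<theta>.hom_inv[of x] FB7.P.m_inv_consistent[OF subgroup_H] by simp

lemma isolated_vertex_exists: "\<exists>s\<in>V. \<forall>v\<in>V. v \<noteq> s \<longrightarrow> \<not> E s v \<and> \<not> E v s"
proof (rule ccontr)
  assume "\<not> ?thesis"
  then have nonisolated: "\<exists>v\<in>V. v \<noteq> u \<and> (E u v \<or> E v u)" if "u \<in> V" for u
    using that by blast
  have hom: "(\<lambda>r. flow \<one>\<^bsub>FB7\<^esub> (\<psi> r)) \<in> hom (raag V E) integer_group"
    using subsetD[OF H_PFB7 \<psi>_closed] subsetD[OF H_FB7 \<psi>_closed]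
    by (intro homI) (simp_all add: \<psi>_mult flow_mult)
  have zero: "group_hom (raag V E) integer_group (\<lambda>_. 0)"
    using group_raag by (intro group_hom.intro group_hom_axioms.intro) (auto simp: hom_def)
  have "flow \<one>\<^bsub>FB7\<^esub> (\<psi> (vgen V E u)) = 0" if u: "u \<in> V" for u
  proof -
    obtain v where v: "v \<in> V" "v \<noteq> u" "E u v \<or> E v u" using nonisolated[OF u] by blast
    have c: "vgen V E u \<in> carrier (raag V E)" "vgen V E v \<in> carrier (raag V E)"
      using u v by (auto intro: vgen_closed)
    have "\<psi> (vgen V E u) \<star> \<psi> (vgen V E v) = \<psi> (vgen V E v) \<star> \<psi> (vgen V E u)"
      using arg_cong[OF vgen_comm[OF u v(1,3)], of \<psi>] unfolding \<psi>_mult[OF c] \<psi>_mult[OF c(2,1)] .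
    moreover have "FB7.P.independent (\<psi> (vgen V E u)) (\<psi> (vgen V E v))"
      using u v c by (intro \<psi>_independent vgen_independent) auto
    ultimately show ?thesis
      using subsetD[OF H_PFB7 \<psi>_closed[OF c(1)]] subsetD[OF H_FB7 \<psi>_closed[OF c(2)]]
      by (intro flow_independent)
  qed
  then have "flow \<one>\<^bsub>FB7\<^esub> (\<psi> r) = 0" if "r \<in> carrier (raag V E)" for r
    using group_hom.hom_eq_on_generate[OF zero hom, of "vgen V E ` V" r] that vgen_closed[of _ V E]
    unfolding generate_vgen by blast
  then have zero_H: "flow \<one>\<^bsub>FB7\<^esub> x = 0" if "x \<in> H" for x
    using \<psi>_\<theta>[OF that] \<theta>_closed[OF that] by metis
  obtain n where n: "n > (0::nat)" "\<And>g. g \<in> carrier PFB7 \<Longrightarrow> g [^]\<^bsub>FB7\<^esub> n \<in> H"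
    using pow_in_H by blast
  define g where "g = (\<sigma> 3 \<star> \<sigma> 4) [^]\<^bsub>FB7\<^esub> (3::nat)"
  have g: "g \<in> carrier PFB7" "flow \<one>\<^bsub>FB7\<^esub> g = - 1"
    unfolding g_def by (rule sigma_3_sigma_4_pure, rule flow_sigma_3_sigma_4)
  \<comment> \<open>The \<open>n\<close>-th power of \<open>g\<close> lies in \<open>H\<close>, yet
    its count is \<open>-n\<close>.\<close>
  have "flow \<one>\<^bsub>FB7\<^esub> (g [^]\<^bsub>FB7\<^esub> n) = 0" by (intro zero_H n(2) g(1))
  then show False using flow_pow[OF g(1), of n] g(2) n(1) by simp
qed

lemma no_isolated_vertex:
  assumes s: "s \<in> V" and isolated: "\<And>v. v \<in> V \<Longrightarrow> v \<noteq> s \<Longrightarrow> \<not> E s v \<and> \<not> E v s"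
  shows False
proof -
  obtain D where D: "R.derivation D" and Ds: "D (vgen V E s) = (\<lambda>x. of_bool (x = \<one>\<^bsub>raag V E\<^esub>))"
    using fox_derivation[OF s, of E] isolated by blast
  obtain n where n: "n > (0::nat)" "\<And>g. g \<in> carrier PFB7 \<Longrightarrow> g [^]\<^bsub>FB7\<^esub> n \<in> H"
    using pow_in_H by blast
  \<comment> \<open>The factor 3 makes the elements pure, the factor \<open>n\<close> brings them
    and all their conjugates into \<open>H\<close>.\<close>
  define x0 where "x0 = (\<sigma> 1 \<star> \<sigma> 2) [^]\<^bsub>FB7\<^esub> (3 * n)"
  define y0 where "y0 = (\<sigma> 5 \<star> \<sigma> 6) [^]\<^bsub>FB7\<^esub> (3 * n)"
  have c: "x0 \<in> carrier FB7" "y0 \<in> carrier FB7" by (simp_all add: x0_def y0_def)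
  have ind: "FB7.P.independent x0 y0"
    unfolding x0_def y0_def using n(1) by (intro pow_sigma_independent) simp
  have comm_x0: "\<sigma> i \<star> x0 = x0 \<star> \<sigma> i" if "i \<in> {4, 5, 6}" for i
    unfolding x0_def using that by (intro pow_comm_sigma) auto
  have comm_y0: "\<sigma> i \<star> y0 = y0 \<star> \<sigma> i" if "i \<in> {1, 2, 3}" for i
    unfolding y0_def using that by (intro pow_comm_sigma) auto
  have comm: "x0 \<star> y0 = y0 \<star> x0"
  proof -
    have "\<sigma> 1 \<star> \<sigma> 2 \<star> y0 = \<sigma> 1 \<star> (y0 \<star> \<sigma> 2)"
      using c comm_y0[of 2] by (simp add: FB7.P.m_assoc)
    also have "\<dots> = y0 \<star> (\<sigma> 1 \<star> \<sigma> 2)"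
      using c comm_y0[of 1] by (simp add: FB7.P.m_assoc[symmetric])
    finally show ?thesis unfolding x0_def using c by (intro FB7.P.pow_commutes) auto
  qed
  \<comment> \<open>\<open>H\<close> need not be normal in \<open>FB7\<close>, but
    \<open>PFB7\<close> is: the pure cube is conjugated first and raised to the power
    \<open>n\<close> afterwards.\<close>
  have conj_H: "w \<star> (\<sigma> i \<star> \<sigma> k) [^]\<^bsub>FB7\<^esub> (3 * n) \<star> FB7_inv w \<in> H"
    if w: "w \<in> carrier FB7" and ik: "i \<in> {1..6}" "k \<in> {1..6}" "k = Suc i" for w i k
  proof -
    let ?g = "(\<sigma> i \<star> \<sigma> k) [^]\<^bsub>FB7\<^esub> (3::nat)"
    have g: "?g \<in> carrier FB7" using ik by simp
    then have "w \<star> ?g \<star> FB7_inv w \<in> carrier PFB7"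
      using w perm_conj[of ?g "FB7_inv w"] sigma_pair_cube_pure[OF ik] by simp
    then have "(w \<star> ?g \<star> FB7_inv w) [^]\<^bsub>FB7\<^esub> n \<in> H" by (rule n(2))
    moreover have "?g [^]\<^bsub>FB7\<^esub> n = (\<sigma> i \<star> \<sigma> k) [^]\<^bsub>FB7\<^esub> (3 * n)"
      using ik by (intro FB7.P.nat_pow_pow FB7.P.m_closed sigma_closed)
    ultimately show ?thesis using FB7.P.pow_conj[OF w g, of n] by simp
  qed
  define cx where "cx w = w \<star> x0 \<star> FB7_inv w" for w
  define cy where "cy w = w \<star> y0 \<star> FB7_inv w" for w
  have cH: "cx w \<in> H" "cy w \<in> H" if "w \<in> carrier FB7" for w
    unfolding cx_def cy_def x0_def y0_def by (rule conj_H[OF that]; simp)+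
  have c_ind: "R.independent (\<theta> (cx w)) (\<theta> (cy w))" if "w \<in> carrier FB7" for w
    using FB7.P.independent_conj[OF ind c that] cH[OF that] \<theta>_independent
    by (simp add: cx_def cy_def)
  have c_comm: "\<theta> (cx w) \<otimes>\<^bsub>raag V E\<^esub> \<theta> (cy w) = \<theta> (cy w) \<otimes>\<^bsub>raag V E\<^esub> \<theta> (cx w)"
    if w: "w \<in> carrier FB7" for w
  proof -
    have "w \<star> a \<star> FB7_inv w \<star> (w \<star> b \<star> FB7_inv w) = w \<star> (a \<star> b) \<star> FB7_inv w"
      if "a \<in> carrier FB7" "b \<in> carrier FB7" for a b
    proof -
      have "w \<star> a \<star> FB7_inv w \<star> (w \<star> b \<star> FB7_inv w) = w \<star> a \<star> (FB7_inv w \<star> w) \<star> b \<star> FB7_inv w"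
        using w that by (simp only: FB7.P.m_assoc FB7.P.m_closed FB7.P.inv_closed)
      then show ?thesis using w that by (simp add: FB7.P.m_assoc)
    qed
    then have "cx w \<star> cy w = cy w \<star> cx w" using c comm by (simp add: cx_def cy_def)
    from arg_cong[OF this, of \<theta>] show ?thesis
      unfolding \<theta>_mult[OF cH(1)[OF w] cH(2)[OF w]] \<theta>_mult[OF cH(2)[OF w] cH(1)[OF w]] .
  qed
  \<comment> \<open>Independence gives infinite order, so no positive power fixes a point of the
    regular action; this is the hypothesis under which chains are unique.\<close>
  have free: "r [^]\<^bsub>raag V E\<^esub> k \<otimes>\<^bsub>raag V E\<^esub> x \<noteq> x"
    if "w \<in> carrier FB7" "r \<in> {\<theta> (cx w), \<theta> (cy w)}" "x \<in> carrier (raag V E)" "k > (0::nat)" for w r x k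
  proof -
    have r: "r \<in> carrier (raag V E)" using that(2) cH[OF that(1)] \<theta>_closed by auto
    have "r [^]\<^bsub>raag V E\<^esub> k \<noteq> \<one>\<^bsub>raag V E\<^esub>"
      using R.independent_pow_neq_one[OF c_ind[OF that(1)] _ _ that(4)] cH[OF that(1)] \<theta>_closed that(2) by auto
    then show ?thesis using r that(3) by (metis R.nat_pow_closed R.r_cancel_one)
  qed
  have "\<exists>m. m \<in> R.chains \<and> D (\<theta> (cx w)) = (\<lambda>x. R.shift (\<theta> (cx w)) m x - m x)
      \<and> D (\<theta> (cy w)) = (\<lambda>x. R.shift (\<theta> (cy w)) m x - m x)" if w: "w \<in> carrier FB7" for w
  proof -
    have cl: "\<theta> (cx w) \<in> carrier (raag V E)" "\<theta> (cy w) \<in> carrier (raag V E)"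
      using cH[OF w] \<theta>_closed by auto
    show ?thesis
    proof (rule R.derivation_inner_on_free_pair[OF D cl c_comm[OF w]])
      fix x and i j i' j' :: nat
      let ?u = "inv\<^bsub>raag V E\<^esub> \<theta> (cx w)" and ?v = "inv\<^bsub>raag V E\<^esub> \<theta> (cy w)"
      assume x: "x \<in> carrier (raag V E)"
        and "?u [^]\<^bsub>raag V E\<^esub> i \<otimes>\<^bsub>raag V E\<^esub> ?v [^]\<^bsub>raag V E\<^esub> j \<otimes>\<^bsub>raag V E\<^esub> x
           = ?u [^]\<^bsub>raag V E\<^esub> i' \<otimes>\<^bsub>raag V E\<^esub> ?v [^]\<^bsub>raag V E\<^esub> j' \<otimes>\<^bsub>raag V E\<^esub> x"
      then have "?u [^]\<^bsub>raag V E\<^esub> i \<otimes>\<^bsub>raag V E\<^esub> ?v [^]\<^bsub>raag V E\<^esub> j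
          = ?u [^]\<^bsub>raag V E\<^esub> i' \<otimes>\<^bsub>raag V E\<^esub> ?v [^]\<^bsub>raag V E\<^esub> j'"
        using cl by (subst (asm) R.r_cancel) auto
      then show "i = i' \<and> j = j'"
        using R.independent_inv[OF cl c_comm[OF w] c_ind[OF w]] unfolding R.independent_def by blast
    qed blast
  qed
  then have "\<exists>m. \<forall>w\<in>carrier FB7. m w \<in> R.chains \<and> D (\<theta> (cx w)) = (\<lambda>x. R.shift (\<theta> (cx w)) (m w) x - m w x)
      \<and> D (\<theta> (cy w)) = (\<lambda>x. R.shift (\<theta> (cy w)) (m w) x - m w x)"
    by (intro bchoice ballI)
  then obtain m where m: "\<And>w. w \<in> carrier FB7 \<Longrightarrow> m w \<in> R.chains"
    and mx: "\<And>w. w \<in> carrier FB7 \<Longrightarrow> D (\<theta> (cx w)) = (\<lambda>x. R.shift (\<theta> (cx w)) (m w) x - m w x)"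
    and my: "\<And>w. w \<in> carrier FB7 \<Longrightarrow> D (\<theta> (cy w)) = (\<lambda>x. R.shift (\<theta> (cy w)) (m w) x - m w x)"
    by blast
  \<comment> \<open>Every generator commutes with \<open>x0\<close> or with \<open>y0\<close>, so
    passing from \<open>w\<close> to \<open>w \<star> \<sigma> i\<close> keeps one member of the
    conjugated pair, and that member alone determines the chain.\<close>
  have step: "m (w \<star> \<sigma> i) = m w" if w: "w \<in> carrier FB7" and i: "i \<in> {1..6}" for w i
  proof -
    have wi: "w \<star> \<sigma> i \<in> carrier FB7" using w i by simp
    have conj_eq: "w \<star> \<sigma> i \<star> a \<star> FB7_inv (w \<star> \<sigma> i) = w \<star> a \<star> FB7_inv w"
      if a: "a \<in> carrier FB7" "\<sigma> i \<star> a = a \<star> \<sigma> i" for a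
    proof -
      have "w \<star> \<sigma> i \<star> a \<star> FB7_inv (w \<star> \<sigma> i) = w \<star> (\<sigma> i \<star> a) \<star> \<sigma> i \<star> FB7_inv w"
        using w i a(1) by (simp add: FB7.P.inv_mult_group inv_sigma FB7.P.m_assoc)
      also have "\<dots> = w \<star> a \<star> (\<sigma> i \<star> \<sigma> i) \<star> FB7_inv w"
        unfolding a(2) using w i a(1) by (simp add: FB7.P.m_assoc)
      finally show ?thesis using w i a(1) by (simp add: sigma_sq)
    qed
    have "i \<in> {4, 5, 6} \<or> i \<in> {1, 2, 3}" using i by auto
    then show ?thesis
    proof
      assume "i \<in> {4, 5, 6}"
      then have eq: "cx (w \<star> \<sigma> i) = cx w" unfolding cx_def using c comm_x0 by (intro conj_eq) auto
      have "(\<lambda>x. R.shift (\<theta> (cx w)) (m (w \<star> \<sigma> i)) x - m (w \<star> \<sigma> i) x)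
          = (\<lambda>x. R.shift (\<theta> (cx w)) (m w) x - m w x)"
        using mx[OF w] mx[OF wi] unfolding eq by metis
      then show ?thesis
        using cH[OF w] \<theta>_closed free[OF w] by (intro R.inner_chain_unique[OF m[OF wi] m[OF w]]) auto
    next
      assume "i \<in> {1, 2, 3}"
      then have eq: "cy (w \<star> \<sigma> i) = cy w" unfolding cy_def using c comm_y0 by (intro conj_eq) auto
      have "(\<lambda>x. R.shift (\<theta> (cy w)) (m (w \<star> \<sigma> i)) x - m (w \<star> \<sigma> i) x)
          = (\<lambda>x. R.shift (\<theta> (cy w)) (m w) x - m w x)"
        using my[OF w] my[OF wi] unfolding eq by metis
      then show ?thesis
        using cH[OF w] \<theta>_closed free[OF w] by (intro R.inner_chain_unique[OF m[OF wi] m[OF w]]) auto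
    qed
  qed
  define m0 where "m0 = m \<one>\<^bsub>FB7\<^esub>"
  \<comment> \<open>The generators reach all of \<open>FB7\<close>, so one chain serves every
    conjugate, also those by elements outside \<open>H\<close>, on which \<open>D\<close> has no
    meaning.\<close>
  have m_const: "m w = m0" if "w \<in> carrier FB7" for w
  proof -
    have "m (sprod is) = m0" if "set is \<subseteq> {1..6}" for "is"
      using that
    proof (induction "is" rule: rev_induct)
      case (snoc i "is")
      then have "set is \<subseteq> {1..6}" "i \<in> {1..6}" by auto
      with snoc.IH show ?case by (simp add: sprod_snoc step)
    qed (simp add: m0_def)
    then show ?thesis using that parabolic_sprod[of "{1..6}" w] parabolic_top by auto
  qed
  have m0: "m0 \<in> R.chains" unfolding m0_def by (rule m) simp
  define r where "r = vgen V E s"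
  define h where "h = \<psi> r"
  have r: "r \<in> carrier (raag V E)" unfolding r_def using s by (rule vgen_closed)
  have h: "h \<in> H" "h \<in> carrier FB7" "\<theta> h = r"
    using r \<psi>_closed H_FB7 \<theta>_\<psi> by (auto simp: h_def)
  have one: "\<one>\<^bsub>FB7\<^esub> \<in> carrier FB7" by simp
  define z where "z = \<theta> (cx \<one>\<^bsub>FB7\<^esub>)"
  have z: "z \<in> carrier (raag V E)" unfolding z_def using cH[OF one] \<theta>_closed by blast
  have cxh: "\<theta> (cx h) = r \<otimes>\<^bsub>raag V E\<^esub> z \<otimes>\<^bsub>raag V E\<^esub> inv\<^bsub>raag V E\<^esub> r"
  proof -
    have "cx h = h \<star> cx \<one>\<^bsub>FB7\<^esub> \<star> FB7_inv h" using c h by (simp add: cx_def)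
    then show ?thesis
      using h cH(1)[OF one] subgroup_H
      by (simp add: \<theta>_mult \<theta>_inv subgroup.m_closed subgroup.m_inv_closed z_def)
  qed
  \<comment> \<open>The same chain \<open>m0\<close> makes \<open>D\<close> inner at
    \<open>z\<close> and at its conjugate by \<open>r\<close>, hence at \<open>r\<close>
    itself.\<close>
  have "D r = (\<lambda>x. R.shift r m0 x - m0 x)"
  proof (rule R.derivation_inner_conj[OF D r z m0])
    show "D z = (\<lambda>x. R.shift z m0 x - m0 x)"
      unfolding z_def m0_def by (rule mx[OF one])
    show "D (r \<otimes>\<^bsub>raag V E\<^esub> z \<otimes>\<^bsub>raag V E\<^esub> inv\<^bsub>raag V E\<^esub> r)
        = (\<lambda>x. R.shift (r \<otimes>\<^bsub>raag V E\<^esub> z \<otimes>\<^bsub>raag V E\<^esub> inv\<^bsub>raag V E\<^esub> r) m0 x - m0 x)"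
      using mx[OF h(2)] unfolding cxh m_const[OF h(2)] .
    show "(r \<otimes>\<^bsub>raag V E\<^esub> z \<otimes>\<^bsub>raag V E\<^esub> inv\<^bsub>raag V E\<^esub> r) [^]\<^bsub>raag V E\<^esub> k \<otimes>\<^bsub>raag V E\<^esub> x \<noteq> x"
      if "x \<in> carrier (raag V E)" "k > (0::nat)" for x k
      unfolding cxh[symmetric] using that by (intro free[OF h(2)]) auto
  qed
  \<comment> \<open>The augmentation is invariant under translation, so it kills the coboundary; but
    \<open>D r\<close> is a single point of mass 1.\<close>
  then have "R.pair (\<lambda>_. 1) (D r) = R.pair (\<lambda>_. 1) (R.shift r m0) - R.pair (\<lambda>_. 1) m0"
    using m0 r by (simp add: R.pair_diff R.shift_chain)
  also have "\<dots> = 0" using m0 r by (simp add: R.pair_shift)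
  also have "R.pair (\<lambda>_. 1) (D r) = 1" unfolding r_def Ds by (simp add: R.pair_def)
  finally show False by simp
qed

end

theorem theorem1p7:
  fixes V :: "'v set" and E :: "'v \<Rightarrow> 'v \<Rightarrow> bool"
  shows "\<not> (\<exists>H. subgroup H PFB7 \<and> finite (rcosets\<^bsub>PFB7\<^esub> H)
              \<and> PFB7\<lparr>carrier := H\<rparr> \<cong> raag V E)"
proof
  assume "\<exists>H. subgroup H PFB7 \<and> finite (rcosets\<^bsub>PFB7\<^esub> H) \<and> PFB7\<lparr>carrier := H\<rparr> \<cong> raag V E"
  then obtain H \<theta> where "subgroup H PFB7" "finite (rcosets\<^bsub>PFB7\<^esub> H)"
    "\<theta> \<in> iso (PFB7\<lparr>carrier := H\<rparr>) (raag V E)"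
    unfolding is_iso_def by blast
  then interpret raag_in_PFB7 V E H \<theta> by (intro raag_in_PFB7.intro)
  show False using isolated_vertex_exists no_isolated_vertex by blast
qed

end
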